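(* Let $k\ge 4$ and for $N\ge 0$ let $c_N$ be the number of proper $k$-partitions of a convex $(N+2)$-gon $P$ whose vertices have been colored cyclically with $1,2,\ldots,k$. Then $c_0=1$ and for $N\ge 1$ $$ c_N= \begin{cases} \dfrac{1}{n}\dbinom{(k-1)^2 n}{n-1} & \text{if } N=(k-2)kn \text{ for some integer } n\ge 1,\\[3mm] \dfrac{k-1}{n}\dbinom{(k-1)^2 n+(k-2)}{n-1} & \text{if } N=(k-2)(kn+1) \text{ for some integer } n\ge 0,\\[3mm] 0 & \text{otherwise,} \end{cases} $$ where for $n=0$ (that is, $N=k-2$) the second expression is interpreted as $1$.
   Context: $P$ is a convex polygon drawn with a horizontal edge at the top. The vertices are colored counterclockwise with the sequence $1,2,\ldots,k,1,2,\ldots,k,\ldots$, starting at the left endpoint of the top edge. A $k$-partition of $P$ is a set of chords between vertices of $P$, no two crossing in the interior of $P$, such that all bounded regions are $k$-gons with vertices among those of $P$. It is proper if every $k$-gon contains all $k$ colors among its vertices. By convention, a polygon with $2$ vertices is a single edge and has exactly one proper $k$-partition. *)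

theory Defs
  imports "HOL-Analysis.Analysis"
begin

(* The points v 0, ..., v (m - 1) are, in counterclockwise order, the vertices of a strictly convex
   m-gon: any three of them, taken in index order, make a left turn (the imaginary part is the
   determinant of the two difference vectors). Injectivity only matters for the degenerate 2-gon,
   a single edge. In the drawing with the edge from v 0 to v (m - 1) horizontal at the top,
   v 0 is its left endpoint; this normalisation is only a rotation and is not imposed. *)
definition convex_polygon :: "nat \<Rightarrow> (nat \<Rightarrow> complex) \<Rightarrow> bool" where
  "convex_polygon m v \<longleftrightarrow> inj_on v {..<m} \<and>
     (\<forall>i j l. i < j \<and> j < l \<and> l < m \<longrightarrow> 0 < Im (cnj (v j - v i) * (v l - v i)))"

definition colour :: "nat \<Rightarrow> nat \<Rightarrow> nat" where
  "colour k i = i mod k + 1"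

definition sides :: "nat \<Rightarrow> (nat \<Rightarrow> complex) \<Rightarrow> complex set set" where
  "sides m v = {closed_segment (v i) (v (Suc i mod m)) | i. i < m}"

(* The sides always belong to the drawing, so only proper diagonals may be chosen as chords. *)
definition chords :: "nat \<Rightarrow> (nat \<Rightarrow> complex) \<Rightarrow> complex set set" where
  "chords m v = {closed_segment (v i) (v j) | i j. i < m \<and> j < m \<and> i \<noteq> j} - sides m v"

definition bounded_regions :: "nat \<Rightarrow> (nat \<Rightarrow> complex) \<Rightarrow> complex set set \<Rightarrow> complex set set" where
  "bounded_regions m v D = {R \<in> components (- (\<Union> (sides m v) \<union> \<Union> D)). bounded R}"

(* A k-gon with vertices among those of the polygon is given by a k-element set S of vertex
   indices; the corresponding open region is the interior of the convex hull of v ` S. *)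
definition k_partition :: "nat \<Rightarrow> nat \<Rightarrow> (nat \<Rightarrow> complex) \<Rightarrow> complex set set \<Rightarrow> bool" where
  "k_partition k m v D \<longleftrightarrow>
     D \<subseteq> chords m v \<and>
     (\<forall>c\<in>D. \<forall>d\<in>D. c \<noteq> d \<longrightarrow> c \<inter> d \<inter> interior (convex hull (v ` {..<m})) = {}) \<and>
     (\<forall>R\<in>bounded_regions m v D.
        \<exists>S\<subseteq>{..<m}. card S = k \<and> R = interior (convex hull (v ` S)))"

definition proper_k_partition :: "nat \<Rightarrow> nat \<Rightarrow> (nat \<Rightarrow> complex) \<Rightarrow> complex set set \<Rightarrow> bool" where
  "proper_k_partition k m v D \<longleftrightarrow>
     k_partition k m v D \<and>
     (\<forall>S\<subseteq>{..<m}. card S = k \<and> interior (convex hull (v ` S)) \<in> bounded_regions m v D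
        \<longrightarrow> colour k ` S = {1..k})"

(* For m = 2 there are no chords and no bounded regions, so the single edge has exactly one
   proper k-partition, the empty set, in accordance with the usual convention. *)
definition num_proper_k_partitions :: "nat \<Rightarrow> nat \<Rightarrow> (nat \<Rightarrow> complex) \<Rightarrow> nat" where
  "num_proper_k_partitions k m v = card {D. proper_k_partition k m v D}"

end

theory Submission
  imports Defs
begin

text \<open>
  The vertices are numbered \<open>0, ..., m - 1\<close>, so a chord is a pair of indices \<open>i < j\<close>, called an arc.
  The closing edge \<open>(0, m - 1)\<close> is counted as an arc too: then every arc has exactly one region
  lying directly against it on the side of the vertices between its endpoints, and every bounded
  region arises once in this way. The vertices of that region are the indices between \<open>i\<close> and \<open>j\<close>
  that no smaller arc covers (\<open>face\<close>).

  That these faces really are the bounded components of the complement of the drawing is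
  \<open>bounded_regions_eq_faces\<close>. Open face regions are pairwise disjoint and avoid the drawing because
  an arc always has one of any two faces entirely on one side. They exhaust the interior because a
  point off the drawing lies in the face of the shortest arc below which it lies. Together with
  the exterior they therefore form a partition of the complement into nonempty connected open
  sets, and such a partition is unique.

  For the colours, read the vertices modulo \<open>k\<close>. By induction from the shortest arcs
  outwards every edge of a face joins residues that differ by \<open>1\<close> or \<open>-1\<close>. The boundary path of a face
  thus walks on the cycle of \<open>k\<close> residues in \<open>k - 1\<close> steps of size one; it meets every residue
  precisely when it never turns round. So a face is rainbow iff all its \<open>k - 1\<close> lower edges have the same
  step \<open>c\<close>, and then its top arc has step \<open>(k - 1) c\<close>, that is, \<open>-c\<close>
  (\<open>rainbow_faces_iff_balanced\<close>).

  Consequently proper partitions are plane trees in which the children of a node of step \<open>c\<close> are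
  \<open>k - 1\<close> nodes of step \<open>-c\<close>, and only nodes of step \<open>1\<close> may be leaves. Contracting the inner nodes of
  step \<open>-1\<close> leaves trees in which every inner node has \<open>(k - 1)^2\<close> children. Opening the root of the
  first tree of a forest gives a recursion (\<open>card_forests_Cons\<close>) whose solution is the
  Fuss-Catalan (Raney) number (\<open>raney_closed_form\<close>): a root of step \<open>1\<close> counts as one tree, a root of
  step \<open>-1\<close> as a forest of \<open>k - 1\<close> trees. These are the two nonzero cases of the formula.
\<close>

section \<open>Noncrossing arcs and their faces\<close>

definition noncrossing :: "(nat \<times> nat) set \<Rightarrow> bool" where
  "noncrossing E \<longleftrightarrow> (\<forall>(i, j)\<in>E. \<forall>(p, q)\<in>E. \<not> (i < p \<and> p < j \<and> j < q))"

text \<open>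
  The vertices of \<open>[a, b]\<close> that can be seen from outside. Arcs that leave \<open>[a, b]\<close> are ignored, so that the
  same notion describes both the upper boundary of a whole system of arcs and the lower boundary of
  the region under a single arc.
\<close>
definition exposed :: "nat \<Rightarrow> nat \<Rightarrow> (nat \<times> nat) set \<Rightarrow> nat set" where
  "exposed a b E = {l\<in>{a..b}. \<forall>(p, q)\<in>E. a \<le> p \<longrightarrow> q \<le> b \<longrightarrow> \<not> (p < l \<and> l < q)}"

definition face :: "(nat \<times> nat) set \<Rightarrow> nat \<times> nat \<Rightarrow> nat set" where
  "face E e = exposed (fst e) (snd e) (E - {e})"

definition arcs :: "nat \<Rightarrow> nat \<Rightarrow> (nat \<times> nat) set" where
  "arcs a b = {(i, j). a \<le> i \<and> i + 2 \<le> j \<and> j \<le> b}"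

text \<open>
  The word of residues along an increasing path of vertices; \<open>1\<close> and \<open>k - 1\<close> stand for a step
  forward or backward on the cycle of colours.
\<close>
fun steps :: "nat \<Rightarrow> nat list \<Rightarrow> nat list" where
  "steps k (x # y # zs) = ((y - x) mod k) # steps k (y # zs)"
| "steps k _ = []"

text \<open>
  The form that the rainbow condition takes once the face boundaries are known to be walks on the
  cycle of colours: each face is traversed without turning round.
\<close>
definition balanced :: "nat \<Rightarrow> (nat \<times> nat) set \<Rightarrow> bool" where
  "balanced k E \<longleftrightarrow>
     (\<forall>e\<in>E. \<exists>c\<in>{1, k - 1}. steps k (sorted_list_of_set (face E e)) = replicate (k - 1) c)"

text \<open>
  A balanced arc system on \<open>[a, b]\<close> whose exposed path spells \<open>w\<close> is an ordered forest: every letter of \<open>w\<close>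
  is the step of the root of one tree, and an edge \<open>(i, i + 1)\<close> of the path is a leaf.
\<close>
definition forests :: "nat \<Rightarrow> nat \<Rightarrow> nat \<Rightarrow> nat list \<Rightarrow> (nat \<times> nat) set set" where
  "forests k a b w =
     {E. E \<subseteq> arcs a b \<and> noncrossing E \<and> balanced k E \<and>
         steps k (sorted_list_of_set (exposed a b E)) = w}"

lemma sorted_list_of_set_eqI:
  assumes "sorted_wrt (<) xs" "set xs = A"
  shows "sorted_list_of_set A = (xs :: nat list)"
  using assms by (metis sorted_list_of_set.idem_if_sorted_distinct strict_sorted_iff)

lemma noncrossingD:
  "noncrossing E \<Longrightarrow> (i, j) \<in> E \<Longrightarrow> (p, q) \<in> E \<Longrightarrow> i < p \<Longrightarrow> p < j \<Longrightarrow> j < q \<Longrightarrow> False"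
  unfolding noncrossing_def by blast

lemma noncrossing_subset: "noncrossing E \<Longrightarrow> E' \<subseteq> E \<Longrightarrow> noncrossing E'"
  unfolding noncrossing_def by blast

lemma finite_exposed [simp]: "finite (exposed a b E)"
  unfolding exposed_def by simp

lemma exposed_iff:
  "l \<in> exposed a b E \<longleftrightarrow>
     a \<le> l \<and> l \<le> b \<and> (\<forall>p q. (p, q) \<in> E \<longrightarrow> a \<le> p \<longrightarrow> q \<le> b \<longrightarrow> p < l \<longrightarrow> q \<le> l)"
  unfolding exposed_def by (simp add: Ball_def not_less) (meson not_less)

lemma exposedD:
  "l \<in> exposed a b E \<Longrightarrow> (p, q) \<in> E \<Longrightarrow> a \<le> p \<Longrightarrow> q \<le> b \<Longrightarrow> p < l \<Longrightarrow> q \<le> l"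
  by (auto simp: exposed_iff)

lemma exposed_ends: "a \<le> b \<Longrightarrow> a \<in> exposed a b E \<and> b \<in> exposed a b E"
  by (auto simp: exposed_iff)

lemma exposed_subset: "exposed a b E \<subseteq> {a..b}"
  by (auto simp: exposed_iff)

text \<open>
  If \<open>x\<close> and \<open>y\<close> are neighbours on the exposed path but not neighbouring integers, something covers
  \<open>x + 1\<close>, and the longest arc doing so is \<open>(x, y)\<close>: it starts at \<open>x\<close> because \<open>x\<close> is
  exposed, and its right end is not covered because an arc covering it would cross it, cover \<open>x\<close>, or
  be longer.
\<close>
lemma exposed_adjacent:
  assumes nc: "noncrossing E" and x: "x \<in> exposed a b E" and y: "y \<in> exposed a b E"
    and xy: "x < y" and gap: "\<And>l. l \<in> exposed a b E \<Longrightarrow> x < l \<Longrightarrow> l < y \<Longrightarrow> False"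
  shows "y = Suc x \<or> (x, y) \<in> E"
proof (cases "y = Suc x")
  case False
  have bd: "a \<le> x" "y \<le> b" using x y by (auto simp: exposed_iff)
  have "Suc x \<notin> exposed a b E" using gap False xy by (metis lessI Suc_lessI)
  then obtain p q where pq: "(p, q) \<in> E" "a \<le> p" "q \<le> b" "p < Suc x" "Suc x < q"
    using bd xy by (auto simp: exposed_iff not_le)
  have "p = x" using exposedD[OF x pq(1-3)] pq by linarith
  define Q where "Q = {q. (x, q) \<in> E \<and> q \<le> b}"
  have "Q \<subseteq> {..b}" unfolding Q_def by blast
  then have Q: "finite Q" "q \<in> Q" using finite_subset pq \<open>p = x\<close> by (auto simp: Q_def)
  define g where "g = Max Q"
  have "g \<in> Q" "q \<le> g" unfolding g_def using Max_in[OF Q(1)] Max_ge[OF Q] Q(2) by blast+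
  then have g: "(x, g) \<in> E" "g \<le> b" "q \<le> g" by (auto simp: Q_def)
  have "g \<le> y" using exposedD[OF y g(1) bd(1) g(2)] xy by linarith
  moreover have "\<not> g < y"
  proof
    assume "g < y"
    then moreover have "x < g" using g pq by linarith
    ultimately have "g \<notin> exposed a b E" using gap by blast
    then obtain p' q' where p': "(p', q') \<in> E" "a \<le> p'" "q' \<le> b" "p' < g" "g < q'"
      using bd g pq by (auto simp: exposed_iff not_le)
    have "x \<le> p'" using exposedD[OF x p'(1-3)] p' g pq by linarith
    moreover have "p' \<noteq> x" 
    proof
      assume "p' = x"
      then have "q' \<in> Q" using p' by (simp add: Q_def)
      then have "q' \<le> g" using Max_ge[OF Q(1)] unfolding g_def by blast
      then show False using p' by simp
    qed
    ultimately show False using noncrossingD[OF nc g(1) p'(1)] p' by linarith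
  qed
  ultimately show ?thesis using g by simp
qed simp

lemma steps_append: "steps k (xs @ x # ys) = steps k (xs @ [x]) @ steps k (x # ys)"
  by (induction k xs rule: steps.induct) auto

lemma length_steps: "length (steps k xs) = length xs - 1"
  by (induction k xs rule: steps.induct) auto

text \<open>
  The differences telescope.
\<close>
lemma steps_mod:
  assumes "sorted_wrt (<) (x # xs)" 
  shows "(last (x # xs) - x) mod k = sum_list (steps k (x # xs)) mod k \<and> x \<le> last (x # xs)"
  using assms
proof (induction xs arbitrary: x)
  case (Cons y ys)
  have "(last (y # ys) - y) mod k = sum_list (steps k (y # ys)) mod k" "y \<le> last (y # ys)" "x < y"
    using Cons by auto
  moreover have "last (x # y # ys) - x = (y - x) + (last (y # ys) - y)" 
    using \<open>y \<le> last (y # ys)\<close> \<open>x < y\<close> by simp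
  moreover have "((y - x) + (last (y # ys) - y)) mod k = ((y - x) mod k + sum_list (steps k (y # ys))) mod k"
    using \<open>(last (y # ys) - y) mod k = sum_list (steps k (y # ys)) mod k\<close> by (metis mod_add_eq mod_mod_trivial)
  ultimately show ?case by simp
qed simp

lemma sorted_list_of_exposed:
  assumes "a < b"
  obtains q rest where "sorted_list_of_set (exposed a b E) = a # q # rest"
proof -
  let ?X = "exposed a b E"
  have ab: "a \<in> ?X" "b \<in> ?X" using exposed_ends[of a b E] assms by auto
  have "Min ?X = a"
    using ab(1) exposed_subset[of a b E] by (intro Min_eqI) auto
  then have L: "sorted_list_of_set ?X = a # sorted_list_of_set (?X - {a})"
    using ab(1) sorted_list_of_set_nonempty[of ?X] by auto
  have "b \<in> ?X - {a}" using ab assms by simp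
  then have "?X - {a} \<noteq> {}" by blast
  then have "sorted_list_of_set (?X - {a}) \<noteq> []" by simp
  then obtain q rest where "sorted_list_of_set (?X - {a}) = q # rest"
    by (meson neq_Nil_conv)
  then show ?thesis using that L by metis
qed

lemma sorted_list_of_set_split:
  fixes A B :: "nat set"
  assumes "finite A" "finite B" "\<And>x y. x \<in> A \<Longrightarrow> y \<in> B \<Longrightarrow> x < y"
  shows "sorted_list_of_set (A \<union> B) = sorted_list_of_set A @ sorted_list_of_set B"
  by (rule sorted_list_of_set_eqI) (use assms in \<open>auto simp: sorted_wrt_append\<close>)

text \<open>
  Adding an arc from \<open>a\<close> to an exposed vertex \<open>q\<close> hides the part of the exposed path before \<open>q\<close>. This
  part becomes the boundary of the new face, and no other face changes.
\<close>
context
  fixes a b q :: nat and E :: "(nat \<times> nat) set"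
  assumes E: "E \<subseteq> arcs a b" and q: "q \<in> exposed a b E" and new: "a + 2 \<le> q" "(a, q) \<notin> E"
begin

lemma exposed_under_new_arc: "exposed a q E = exposed a b E \<inter> {..q}"
proof -
  have "q \<le> b" using q by (simp add: exposed_iff)
  have "l \<in> exposed a q E \<longleftrightarrow> l \<in> exposed a b E" if "l \<le> q" for l
  proof
    assume l: "l \<in> exposed a q E"
    have "s \<le> l" if "(p, s) \<in> E" "a \<le> p" "s \<le> b" "p < l" for p s
    proof -
      have "s \<le> q" using exposedD[OF q that(1-3)] that \<open>l \<le> q\<close> by linarith
      then show ?thesis using exposedD[OF l that(1,2) _ that(4)] by blast
    qed
    then show "l \<in> exposed a b E" using l \<open>q \<le> b\<close> by (simp add: exposed_iff)
  next
    assume l: "l \<in> exposed a b E"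
    have "s \<le> l" if "(p, s) \<in> E" "a \<le> p" "s \<le> q" "p < l" for p s
      using exposedD[OF l that(1,2) _ that(4)] that \<open>q \<le> b\<close> by linarith
    then show "l \<in> exposed a q E" using l \<open>l \<le> q\<close> by (simp add: exposed_iff)
  qed
  then show ?thesis using exposed_subset[of a q E] by auto
qed

lemma exposed_insert_arc: "exposed a b (insert (a, q) E) = insert a (exposed a b E \<inter> {q..})"
proof -
  have q': "a \<le> q" "q \<le> b" using q by (simp_all add: exposed_iff)
  have "l \<in> exposed a b (insert (a, q) E) \<longleftrightarrow> l = a \<or> l \<in> exposed a b E \<and> q \<le> l" for l
  proof
    assume "l \<in> exposed a b (insert (a, q) E)"
    then show "l = a \<or> l \<in> exposed a b E \<and> q \<le> l"
      using exposedD[of l a b "insert (a, q) E" a q] q' by (auto simp: exposed_iff)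
  next
    assume "l = a \<or> l \<in> exposed a b E \<and> q \<le> l"
    then show "l \<in> exposed a b (insert (a, q) E)"
      using q' new by (auto simp: exposed_iff)
  qed
  then show ?thesis by auto
qed

lemma sorted_exposed_insert_arc:
  "\<exists>rest. sorted_list_of_set (exposed a b E) = sorted_list_of_set (exposed a q E) @ rest \<and>
          sorted_list_of_set (exposed a b (insert (a, q) E)) = a # q # rest"
proof -
  let ?R = "exposed a b E \<inter> {q<..}"
  have "exposed a b E = exposed a q E \<union> ?R"
    unfolding exposed_under_new_arc by auto
  moreover have "sorted_list_of_set (exposed a q E \<union> ?R) =
      sorted_list_of_set (exposed a q E) @ sorted_list_of_set ?R"
    by (rule sorted_list_of_set_split) (auto simp: exposed_under_new_arc)
  moreover have "exposed a b (insert (a, q) E) = {a, q} \<union> ?R"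
    unfolding exposed_insert_arc using q by (auto simp: order_le_less)
  moreover have "sorted_list_of_set ({a, q} \<union> ?R) = a # q # sorted_list_of_set ?R"
    by (rule sorted_list_of_set_eqI) (use new in auto)
  ultimately show ?thesis by metis
qed

lemma noncrossing_insert_arc: "noncrossing (insert (a, q) E) \<longleftrightarrow> noncrossing E"
proof
  assume nc: "noncrossing E"
  have bd: "a \<le> p" "s \<le> b" if "(p, s) \<in> E" for p s using E that by (auto simp: arcs_def)
  have cov: "s \<le> q" if "(p, s) \<in> E" "p < q" for p s
    using exposedD[OF q that(1) bd[OF that(1)] that(2)] .
  have "\<not> (i < p \<and> p < j \<and> j < s)" if ij: "(i, j) \<in> insert (a, q) E" and ps: "(p, s) \<in> insert (a, q) E"
    for i j p s
  proof
    assume *: "i < p \<and> p < j \<and> j < s"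
    show False
    proof (cases "(i, j) = (a, q)")
      case True
      then show False using * ps cov[of p s] by auto
    next
      case False
      then have "(i, j) \<in> E" using ij by auto
      moreover have "(p, s) \<noteq> (a, q)" using bd[OF \<open>(i, j) \<in> E\<close>] * by auto
      ultimately show False using noncrossingD[OF nc] ps * by blast
    qed
  qed
  then show "noncrossing (insert (a, q) E)" unfolding noncrossing_def by blast
qed (rule noncrossing_subset, auto)

lemma face_insert_arc: "e \<in> E \<Longrightarrow> face (insert (a, q) E) e = face E e"
proof -
  assume e: "e \<in> E"
  obtain i j where ij: "e = (i, j)" by (cases e)
  have bd: "a \<le> i" "j \<le> b" using e E ij by (auto simp: arcs_def)
  have "\<not> (i \<le> a \<and> q \<le> j)"
  proof
    assume *: "i \<le> a \<and> q \<le> j"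
    then have "i = a" using bd by simp
    then have "j \<noteq> q" using e ij new by auto
    then show False using exposedD[OF q e[unfolded ij] bd] * \<open>i = a\<close> new by linarith
  qed
  moreover have "insert (a, q) E - {e} = insert (a, q) (E - {e})" using e new by auto
  ultimately show ?thesis unfolding face_def exposed_def ij by auto
qed

lemma balanced_insert_arc:
  "balanced k (insert (a, q) E) \<longleftrightarrow>
     balanced k E \<and> (\<exists>c\<in>{1, k - 1}. steps k (sorted_list_of_set (exposed a q E)) = replicate (k - 1) c)"
proof -
  have "face (insert (a, q) E) (a, q) = exposed a q E"
    using new by (simp add: face_def)
  moreover have "\<And>e. e \<in> E \<Longrightarrow> face (insert (a, q) E) e = face E e"
    by (rule face_insert_arc)
  ultimately show ?thesis unfolding balanced_def by auto
qed

end


section \<open>Counting forests of balanced arcs\<close>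

lemma mult_pred_mod:
  fixes k c :: nat
  assumes "k \<ge> 2" "c \<in> {1, k - 1}"
  shows "((k - 1) * c) mod k = k - c"
proof -
  obtain l where k: "k = Suc (Suc l)" using assms(1) by (metis Suc_le_D numeral_2_eq_2 Suc_le_mono)
  show ?thesis
  proof (cases "c = 1")
    case False
    then have "c = Suc l" using assms k by auto
    then have "(k - 1) * c = 1 + l * k" using k by (simp add: algebra_simps)
    then show ?thesis using k \<open>c = Suc l\<close> by (simp only: mod_mult_self1) simp
  qed (use k in simp)
qed

lemma last_sorted_list_of_exposed:
  assumes "a \<le> b"
  shows "sorted_list_of_set (exposed a b E) \<noteq> []" "last (sorted_list_of_set (exposed a b E)) = b"
proof -
  have ab: "b \<in> exposed a b E" using exposed_ends[OF assms] by blast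
  have "exposed a b E = (exposed a b E - {b}) \<union> {b}" using ab by blast
  moreover have "sorted_list_of_set ((exposed a b E - {b}) \<union> {b}) =
      sorted_list_of_set (exposed a b E - {b}) @ sorted_list_of_set {b}"
    by (rule sorted_list_of_set_split) (use exposed_subset[of a b E] in \<open>auto simp: order_le_less\<close>)
  ultimately have "sorted_list_of_set (exposed a b E) = sorted_list_of_set (exposed a b E - {b}) @ [b]"
    by simp
  then show "sorted_list_of_set (exposed a b E) \<noteq> []" "last (sorted_list_of_set (exposed a b E)) = b"
    by simp_all
qed

text \<open>
  A path of \<open>k - 1\<close> equal steps \<open>c\<close> amounts to one step \<open>-c\<close>, because
  \<open>(k - 1) c\<close> is congruent to \<open>-c\<close>.
\<close>
lemma residue_of_run:
  assumes "k \<ge> 2" "c \<in> {1, k - 1}" "a < q" "steps k (sorted_list_of_set (exposed a q E)) = replicate (k - 1) c"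
  shows "(q - a) mod k = k - c"
proof -
  obtain x rest where L: "sorted_list_of_set (exposed a q E) = a # x # rest"
    using sorted_list_of_exposed[OF assms(3)] .
  have srt: "sorted_wrt (<) (a # x # rest)" unfolding L[symmetric] by simp
  have "last (a # x # rest) = q"
    using last_sorted_list_of_exposed(2)[of a q E] assms(3) unfolding L by linarith
  then have "(q - a) mod k = sum_list (steps k (a # x # rest)) mod k"
    using steps_mod[OF srt, of k] by simp
  also have "\<dots> = ((k - 1) * c) mod k" using assms(4) L by (simp add: sum_list_replicate)
  finally show ?thesis using mult_pred_mod[OF assms(1,2)] by simp
qed

lemma finite_forests: "finite (forests k a b w)"
proof -
  have "arcs a b \<subseteq> {..b} \<times> {..b}" by (auto simp: arcs_def)
  then have "finite (Pow (arcs a b))" by (meson finite_Pow_iff finite_SigmaI finite_atMost finite_subset)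
  then show ?thesis by (rule rev_finite_subset) (auto simp: forests_def)
qed

lemma forests_Nil:
  assumes "a \<le> b"
  shows "forests k a b [] = (if a = b then {{}} else {})"
proof (cases "a = b")
  case True
  then have "arcs a b = {}" by (auto simp: arcs_def)
  moreover have "exposed a a {} = {a}" by (auto simp: exposed_def)
  ultimately show ?thesis using True by (auto simp: forests_def noncrossing_def balanced_def)
next
  case False
  have "steps k (sorted_list_of_set (exposed a b E)) \<noteq> []" for E
    using sorted_list_of_exposed[of a b E] False assms by (metis le_neq_implies_less list.discI steps.simps(1))
  then show ?thesis using False by (auto simp: forests_def)
qed

lemma forests_length_le:
  assumes "E \<in> forests k a b w" "a \<le> b"
  shows "length w \<le> b - a"
proof -
  have "length w = card (exposed a b E) - 1"
    using assms by (auto simp: forests_def length_steps)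
  also have "\<dots> \<le> card {a..b} - 1"
    using card_mono[OF finite_atLeastAtMost exposed_subset, of a b E] by (simp add: diff_le_mono)
  finally show ?thesis using assms by simp
qed

lemma exposed_Suc:
  assumes "E \<subseteq> arcs (Suc a) b" "a < b"
  shows "exposed a b E = insert a (exposed (Suc a) b E)"
proof -
  have "l \<in> exposed a b E \<longleftrightarrow> l = a \<or> l \<in> exposed (Suc a) b E" for l
    using assms by (auto simp: exposed_iff arcs_def)
  then show ?thesis by blast
qed

text \<open>
  If the first tree is a leaf, no arc starts at \<open>a\<close>, as it would cover \<open>a + 1\<close>; the vertex \<open>a\<close> can be
  dropped.
\<close>
lemma forests_leaf:
  assumes "a < b" "k \<ge> 2"
  shows "{E \<in> forests k a b (c # w). sorted_list_of_set (exposed a b E) ! 1 = Suc a} =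
    (if c = 1 then forests k (Suc a) b w else {})"
proof -
  have list: "sorted_list_of_set (exposed a b E) = a # sorted_list_of_set (exposed (Suc a) b E)"
    if "E \<subseteq> arcs (Suc a) b" for E
    unfolding exposed_Suc[OF that assms(1)]
    by (rule sorted_list_of_set_eqI) (use exposed_subset[of "Suc a" b E] in auto)
  have first: "\<exists>rest. sorted_list_of_set (exposed (Suc a) b E) = Suc a # rest" for E
  proof (cases "Suc a = b")
    case True
    then have "exposed (Suc a) b E = {Suc a}"
      using exposed_subset[of "Suc a" b E] exposed_ends[of "Suc a" b E] by auto
    then show ?thesis by simp
  next
    case False
    then show ?thesis using sorted_list_of_exposed[of "Suc a" b E] assms(1) by (metis Suc_lessI)
  qed
  have no_arc: "E \<subseteq> arcs (Suc a) b"
    if "E \<subseteq> arcs a b" "sorted_list_of_set (exposed a b E) ! 1 = Suc a" for E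
  proof
    fix e assume e: "e \<in> E"
    obtain i j where ij: "e = (i, j)" by (cases e)
    obtain q rest where "sorted_list_of_set (exposed a b E) = a # q # rest"
      using sorted_list_of_exposed[OF assms(1)] .
    then have "Suc a \<in> set (sorted_list_of_set (exposed a b E))" using that by simp
    then have "Suc a \<in> exposed a b E" by simp
    then have "i \<noteq> a" using exposedD[of "Suc a" a b E i j] e ij that(1) by (auto simp: arcs_def)
    then show "e \<in> arcs (Suc a) b" using e ij that(1) by (force simp: arcs_def)
  qed
  have "arcs (Suc a) b \<subseteq> arcs a b" by (auto simp: arcs_def)
  have iff: "E \<in> forests k a b (c # w) \<and> sorted_list_of_set (exposed a b E) ! 1 = Suc a \<longleftrightarrow>
      c = 1 \<and> E \<in> forests k (Suc a) b w" if "E \<subseteq> arcs (Suc a) b" for E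
    using that first[of E] \<open>arcs (Suc a) b \<subseteq> arcs a b\<close> assms(2) by (auto simp: forests_def list)
  show ?thesis
  proof (rule set_eqI)
    fix E
    have "E \<subseteq> arcs a b" if "E \<in> forests k a b (c # w)" using that by (simp add: forests_def)
    moreover have "E \<subseteq> arcs (Suc a) b" if "E \<in> forests k (Suc a) b w" using that by (simp add: forests_def)
    ultimately show "E \<in> {E \<in> forests k a b (c # w). sorted_list_of_set (exposed a b E) ! 1 = Suc a} \<longleftrightarrow>
        E \<in> (if c = 1 then forests k (Suc a) b w else {})"
      using iff[of E] no_arc[of E] by (cases "E \<subseteq> arcs (Suc a) b") auto
  qed
qed

text \<open>
  If the first tree is not a leaf, deleting its outermost arc replaces the letter \<open>c\<close> by the \<open>k - 1\<close> letters
  \<open>-c\<close> of the children. The map below is the inverse operation: the arc to put back ends at the vertex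
  reached after \<open>k - 1\<close> steps of the exposed path.
\<close>
lemma forests_open:
  assumes "a < b" "k \<ge> 3" "c \<in> {1, k - 1}"
  shows "bij_betw (\<lambda>E. insert (a, sorted_list_of_set (exposed a b E) ! (k - 1)) E)
    (forests k a b (replicate (k - 1) (k - c) @ w))
    {E \<in> forests k a b (c # w). sorted_list_of_set (exposed a b E) ! 1 \<noteq> Suc a}"
    (is "bij_betw ?g ?X ?Y")
proof (rule bij_betw_byWitness)
  let ?L = "\<lambda>E. sorted_list_of_set (exposed a b E)"
  let ?f = "\<lambda>E. E - {(a, ?L E ! 1)}"
  have c': "k - c \<in> {1, k - 1}" "k - (k - c) = c" using assms by auto
  have g: "?g E \<in> ?Y \<and> ?f (?g E) = E" if "E \<in> ?X" for E
  proof -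
    have E: "E \<subseteq> arcs a b" "noncrossing E" "balanced k E"
      and st: "steps k (?L E) = replicate (k - 1) (k - c) @ w"
      using that by (auto simp: forests_def)
    define q where "q = ?L E ! (k - 1)"
    have len: "k - 1 < length (?L E)" using arg_cong[OF st, of length] assms(2) by (simp only: length_steps) simp
    have srt: "sorted_wrt (<) (?L E)" by simp
    have "q \<in> set (?L E)" unfolding q_def using len by (rule nth_mem)
    then have q: "q \<in> exposed a b E" by simp
    obtain x r where xr: "?L E = a # x # r" using sorted_list_of_exposed[OF assms(1)] .
    have "?L E ! 0 < ?L E ! 1" "?L E ! 1 < ?L E ! (k - 1)"
      using sorted_wrt_nth_less[OF srt] len assms(2) by auto
    then have x: "a < x" "x < q" unfolding q_def by (simp_all add: xr)
    have "x \<in> set (?L E)" unfolding xr by simp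
    then have "x \<in> exposed a b E" by simp
    have q2: "a + 2 \<le> q" using x by simp
    have qb: "q \<le> b" using q by (simp add: exposed_iff)
    have new: "(a, q) \<notin> E" using exposedD[OF \<open>x \<in> exposed a b E\<close>, of a q] x qb by auto
    obtain rest where rest: "?L E = sorted_list_of_set (exposed a q E) @ rest"
        "?L (insert (a, q) E) = a # q # rest"
      using sorted_exposed_insert_arc[OF E(1) q q2 new] by blast
    define P where "P = sorted_list_of_set (exposed a q E)"
    have P: "P \<noteq> []" "last P = q" unfolding P_def using last_sorted_list_of_exposed[of a q E] q2 by auto
    \<comment> \<open>\<open>P\<close> is the boundary of the new face. It is an initial part of the exposed path and ends in \<open>q\<close>, so it
      has \<open>k - 1\<close> steps.\<close>
    have "?L E ! (length P - 1) = q" using P rest(1) unfolding P_def[symmetric]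
      by (simp add: nth_append last_conv_nth)
    moreover have "length P - 1 < length (?L E)" unfolding rest(1) P_def[symmetric] using P(1) by (cases P) auto
    moreover have "distinct (?L E)" by simp
    ultimately have "length P - 1 = k - 1" using len nth_eq_iff_index_eq unfolding q_def by blast
    moreover have "steps k (?L E) = steps k P @ steps k (q # rest)"
      using steps_append[of k "butlast P" q rest] append_butlast_last_id[OF P(1)] P(2) rest(1)
      unfolding P_def by (metis append.assoc append_Cons append_Nil)
    ultimately have sP: "steps k P = replicate (k - 1) (k - c)" "steps k (q # rest) = w"
      using st by (simp_all add: append_eq_append_conv length_steps)
    have "(q - a) mod k = c"
      using residue_of_run[of k "k - c" a q E] c' sP(1) assms(2) q2 unfolding P_def by auto
    then have "insert (a, q) E \<in> ?Y"
      using E sP balanced_insert_arc[OF E(1) q q2 new, of k] noncrossing_insert_arc[OF E(1) q q2 new]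
        c' q2 qb rest(2) unfolding P_def by (auto simp: forests_def arcs_def)
    then show ?thesis unfolding q_def[symmetric] using new rest(2) by simp
  qed
  have f: "?f E \<in> ?X \<and> ?g (?f E) = E" if "E \<in> ?Y" for E
  proof -
    have E: "E \<subseteq> arcs a b" "noncrossing E" "balanced k E"
      and st: "steps k (?L E) = c # w" and "?L E ! 1 \<noteq> Suc a"
      using that by (auto simp: forests_def)
    obtain q rest where L: "?L E = a # q # rest" using sorted_list_of_exposed[OF assms(1)] .
    have srt: "sorted_wrt (<) (a # q # rest)" unfolding L[symmetric] by simp
    have set: "set (a # q # rest) = exposed a b E" unfolding L[symmetric] by simp
    have "q = Suc a \<or> (a, q) \<in> E"
    proof (rule exposed_adjacent[OF E(2)])
      show "a \<in> exposed a b E" "q \<in> exposed a b E" using set by auto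
      show "a < q" using srt by simp
      show False if "l \<in> exposed a b E" "a < l" "l < q" for l
        using that(2,3) srt unfolding that(1) using that(1) unfolding set[symmetric] by auto
    qed
    then have aq: "(a, q) \<in> E" using \<open>?L E ! 1 \<noteq> Suc a\<close> by (simp add: L)
    define E' where "E' = E - {(a, q)}"
    have EE': "E = insert (a, q) E'" and new: "(a, q) \<notin> E'" using aq unfolding E'_def by auto
    have E': "E' \<subseteq> arcs a b" using E unfolding E'_def by auto
    have q2: "a + 2 \<le> q" using aq E(1) by (auto simp: arcs_def)
    have "q \<in> exposed a b E" using set by auto
    then have q: "q \<in> exposed a b E'" unfolding E'_def exposed_def by auto
    obtain rest' where rest': "?L E' = sorted_list_of_set (exposed a q E') @ rest'"
        "?L E = a # q # rest'"
      using sorted_exposed_insert_arc[OF E' q q2 new] unfolding EE' by blast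
    then have "rest' = rest" using L by simp
    have "noncrossing E'" using noncrossing_subset[OF E(2)] unfolding E'_def by blast
    obtain d where d: "d \<in> {1, k - 1}" "steps k (sorted_list_of_set (exposed a q E')) = replicate (k - 1) d"
        and "balanced k E'"
      using E(3) balanced_insert_arc[OF E' q q2 new, of k] unfolding EE' by blast
    \<comment> \<open>The letter \<open>c\<close> of the deleted arc determines the step \<open>d\<close> of its children.\<close>
    have "(q - a) mod k = k - d" using residue_of_run[OF _ d(1) _ d(2)] assms(2) q2 by auto
    then have "k - d = c" using st L by simp
    then have dc: "d = k - c" using d(1) assms by auto
    define P where "P = sorted_list_of_set (exposed a q E')"
    have P: "P \<noteq> []" "last P = q" unfolding P_def using last_sorted_list_of_exposed[of a q E'] q2 by auto
    have "length P - 1 = k - 1" using arg_cong[OF d(2), of length] unfolding P_def[symmetric]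
      by (simp add: length_steps)
    then have "length P = k" using P(1) assms(2) by (cases P) auto
    then have "?L E' ! (k - 1) = q" using P rest'(1) assms(2) unfolding P_def[symmetric]
      by (simp add: nth_append last_conv_nth)
    moreover have "steps k (?L E') = steps k P @ steps k (q # rest)"
      using steps_append[of k "butlast P" q rest] append_butlast_last_id[OF P(1)] P(2) rest'(1) \<open>rest' = rest\<close>
      unfolding P_def by (metis append.assoc append_Cons append_Nil)
    moreover have "steps k (q # rest) = w" using st L by simp
    ultimately have "E' \<in> ?X" "?g E' = E"
      using E' \<open>noncrossing E'\<close> \<open>balanced k E'\<close> d(2) dc EE' unfolding P_def
      by (simp_all add: forests_def)
    moreover have "?f E = E'" using L unfolding E'_def by simp
    ultimately show ?thesis by simp
  qed
  show "\<forall>E\<in>?X. ?f (?g E) = E" "\<forall>E\<in>?Y. ?g (?f E) = E" "?g ` ?X \<subseteq> ?Y" "?f ` ?Y \<subseteq> ?X"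
    using f g by blast+
qed

lemma card_forests_Cons:
  assumes "a < b" "k \<ge> 3" "c \<in> {1, k - 1}"
  shows "card (forests k a b (c # w)) =
    (if c = 1 then card (forests k (Suc a) b w) else 0) +
    card (forests k a b (replicate (k - 1) (k - c) @ w))"
proof -
  let ?leaf = "\<lambda>E. sorted_list_of_set (exposed a b E) ! 1 = Suc a"
  let ?S = "forests k a b (c # w)"
  have "?S = {E \<in> ?S. ?leaf E} \<union> {E \<in> ?S. \<not> ?leaf E}" by blast
  moreover have "card ({E \<in> ?S. ?leaf E} \<union> {E \<in> ?S. \<not> ?leaf E}) =
      card {E \<in> ?S. ?leaf E} + card {E \<in> ?S. \<not> ?leaf E}"
    by (rule card_Un_disjoint) (use finite_forests[of k a b "c # w"] in auto)
  ultimately have "card ?S = card {E \<in> ?S. ?leaf E} + card {E \<in> ?S. \<not> ?leaf E}" by simp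
  then show ?thesis
    using forests_leaf[OF assms(1), of k c w] assms(2) bij_betw_same_card[OF forests_open[OF assms, of w]]
    by auto
qed

text \<open>
  The number of forests of \<open>r\<close> ordered trees with \<open>n\<close> inner nodes, each having \<open>p\<close> children: the first
  tree is a leaf and is removed, or its root is replaced by its \<open>p\<close> subtrees.
\<close>
fun raney :: "nat \<Rightarrow> nat \<Rightarrow> nat \<Rightarrow> nat" where
  "raney p 0 r = 1"
| "raney p (Suc n) 0 = 0"
| "raney p (Suc n) (Suc r) = raney p (Suc n) r + raney p n (r + p)"

text \<open>
  The closed form satisfies the recursion because of Pascal's rule and the absorption identity
  relating \<open>M choose n\<close> to \<open>M choose (n - 1)\<close>.
\<close>
lemma raney_closed_form:
  shows "p \<ge> 1 \<Longrightarrow> n \<ge> 1 \<Longrightarrow> real n * real (raney p n r) = real r * real ((p * n + r - 1) choose (n - 1))"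
proof (induction p n r rule: raney.induct)
  case (3 p n r)
  have IH: "real (Suc n) * real (raney p (Suc n) r) = real r * real ((p * Suc n + r - 1) choose n)"
    using 3(1) 3(3) by simp
  show ?case
  proof (cases n)
    case 0
    then show ?thesis using IH by simp
  next
    case (Suc m)
    define M where "M = p * Suc n + r - 1"
    have "1 * Suc n \<le> p * Suc n" using 3(3) by (intro mult_right_mono) auto
    then have M: "real M = real p * real (Suc n) + real r - 1" "m \<le> M" "p * Suc n + Suc r - 1 = Suc M"
      using Suc unfolding M_def by (auto simp: of_nat_diff algebra_simps)
    have "p * n + (r + p) - 1 = M" unfolding M_def by (simp add: algebra_simps)
    then have IH2: "real n * real (raney p n (r + p)) = (real r + real p) * real (M choose m)"
      using 3(2) 3(3) Suc by simp
    have "Suc m * (M choose Suc m) = (M - m) * (M choose m)"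
      by (metis binomial_absorption binomial_absorb_comp)
    then have "real n * real (M choose n) = real (M - m) * real (M choose m)"
      unfolding Suc by (metis of_nat_mult)
    then have absorb: "real n * real (M choose n) = (real M - real m) * real (M choose m)"
      using M(2) by (simp add: of_nat_diff)
    have "real n * (real (Suc n) * real (raney p (Suc n) (Suc r))) =
        real n * (real r * real (M choose n)) + real (Suc n) * ((real r + real p) * real (M choose m))"
      using IH IH2 unfolding M_def[symmetric] by (simp add: algebra_simps) 
    also have "\<dots> = real n * (real (Suc r) * real (Suc M choose n))"
    proof -
      have "real (Suc M choose n) = real (M choose n) + real (M choose m)" unfolding Suc by simp
      then show ?thesis using absorb M(1) Suc by (simp add: algebra_simps)
    qed
    finally show ?thesis using Suc M(3) by simp
  qed
qed auto

text \<open>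
  A tree with a root of step \<open>-1\<close> (letter \<open>k - 1\<close>) is never a leaf, so it is determined by its \<open>k - 1\<close>
  subtrees, whose roots have step \<open>1\<close>. A word \<open>w\<close> therefore counts as \<open>sum_list w\<close> trees of step \<open>1\<close>. An inner
  node of such a tree has \<open>(k - 1)^2\<close> grandchildren of step \<open>1\<close>; trading one tree for that many adds
  \<open>(k - 1)^2 - 1\<close>, that is \<open>k (k - 2)\<close>, leaves, and leaves are unit intervals.
  
  The induction measure decreases when the interval shrinks and also when a root is opened, since then the
  word grows; words longer than the interval have no forests.
\<close>
lemma card_forests:
  assumes k: "k \<ge> 3" and "a \<le> b" "set w \<subseteq> {1, k - 1}"
  shows "(\<forall>n. b = a + sum_list w + k * (k - 2) * n \<longrightarrow> card (forests k a b w) = raney ((k - 1)^2) n (sum_list w)) \<and>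
    ((\<nexists>n. b = a + sum_list w + k * (k - 2) * n) \<longrightarrow> forests k a b w = {})"
  using assms(2,3)
proof (induction "2 * (b - a) - length w" arbitrary: a w rule: less_induct)
  case less
  define K where "K = k * (k - 2)"
  obtain l where l: "k = Suc (Suc (Suc l))" using k
    by (metis Suc_le_D numeral_3_eq_3 Suc_le_mono)
  have p: "(k - 1)^2 = Suc K" "K > 0" unfolding K_def l by (simp_all add: power2_eq_square)
  have cancel: "a' + s + K * n = a' + s + K * n' \<longleftrightarrow> n = n'" for a' s n n' :: nat
    using p by simp
  have len_sum: "length w \<le> sum_list w"
    using less.prems(2) k by (induction w) auto
  show ?case
  proof (cases "length w \<le> b - a")
    case False
    then have "forests k a b w = {}" using forests_length_le less.prems(1) by blast
    moreover have "b \<noteq> a + sum_list w + K * n" for n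
      using False len_sum by simp
    ultimately show ?thesis unfolding K_def by blast
  next
    case True
    show ?thesis
    proof (cases w)
      case Nil
      have "raney ((k - 1)^2) n 0 = (if n = 0 then 1 else 0)" for n by (cases n) auto
      then show ?thesis using Nil less.prems(1) p unfolding K_def[symmetric]
        by (auto simp: forests_Nil)
    next
      case (Cons c w')
      then have ab: "a < b" using True by auto
      have c: "c \<in> {1, k - 1}" using less.prems Cons by auto
      let ?u = "replicate (k - 1) (k - c) @ w'"
      have IHu: "\<And>n. b = a + sum_list ?u + K * n \<Longrightarrow> card (forests k a b ?u) = raney ((k - 1)^2) n (sum_list ?u)"
        "(\<nexists>n. b = a + sum_list ?u + K * n) \<Longrightarrow> card (forests k a b ?u) = 0"
      proof -
        have m: "2 * (b - a) - length ?u < 2 * (b - a) - length w"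
          using Cons True ab k by simp
        have su: "set ?u \<subseteq> {1, k - 1}" using less.prems(2) Cons c k by auto
        note H = less.hyps[OF m less.prems(1) su, folded K_def]
        show "card (forests k a b ?u) = raney ((k - 1)^2) n (sum_list ?u)"
          if "b = a + sum_list ?u + K * n" for n using H that by blast
        show "card (forests k a b ?u) = 0" if "\<nexists>n. b = a + sum_list ?u + K * n"
          using H that by (metis card.empty)
      qed
      show ?thesis
      proof (cases "c = 1")
        case c1: True
        have IH1: "\<And>n. b = Suc a + sum_list w' + K * n \<Longrightarrow> card (forests k (Suc a) b w') = raney ((k - 1)^2) n (sum_list w')"
          "(\<nexists>n. b = Suc a + sum_list w' + K * n) \<Longrightarrow> card (forests k (Suc a) b w') = 0"
        proof -
          have m: "2 * (b - Suc a) - length w' < 2 * (b - a) - length w"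
            using Cons True ab by simp
          have su: "Suc a \<le> b" "set w' \<subseteq> {1, k - 1}" using less.prems(2) Cons ab by auto
          note H = less.hyps[OF m su, folded K_def]
          show "card (forests k (Suc a) b w') = raney ((k - 1)^2) n (sum_list w')"
            if "b = Suc a + sum_list w' + K * n" for n using H that by blast
          show "card (forests k (Suc a) b w') = 0" if "\<nexists>n. b = Suc a + sum_list w' + K * n"
            using H that by (metis card.empty)
        qed
        have su: "sum_list ?u = sum_list w' + (k - 1)^2"
          using c1 by (simp add: sum_list_replicate power2_eq_square)
        have sw: "sum_list w = Suc (sum_list w')" using Cons c1 by simp
        have cd: "card (forests k a b w) = card (forests k (Suc a) b w') + card (forests k a b ?u)"
          using card_forests_Cons[OF ab k c, of w'] Cons c1 by simp
        \<comment> \<open>Opening a root of step \<open>1\<close> uses up one of the \<open>n\<close> inner nodes.\<close>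
        have shift: "a + sum_list ?u + K * n = a + sum_list w + K * Suc n" for n
          unfolding su sw p by simp
        have 1: "card (forests k a b w) = raney ((k - 1)^2) n (sum_list w)" if b: "b = a + sum_list w + K * n" for n
        proof (cases n)
          case 0
          have "card (forests k a b ?u) = 0"
          proof (rule IHu(2), rule notI)
            assume "\<exists>n. b = a + sum_list ?u + K * n"
            then obtain n' where "b = a + sum_list w + K * Suc n'" unfolding shift by blast
            then show False using b 0 p by simp
          qed
          then show ?thesis using IH1(1)[of 0] b 0 cd sw by simp
        next
          case (Suc n')
          have "card (forests k a b ?u) = raney ((k - 1)^2) n' (sum_list ?u)"
            using IHu(1)[of n'] b Suc unfolding shift by blast
          moreover have "card (forests k (Suc a) b w') = raney ((k - 1)^2) n (sum_list w')"
            using IH1(1)[of n] b sw by simp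
          ultimately show ?thesis using cd Suc sw su by (simp add: add.commute)
        qed
        have 2: "card (forests k a b w) = 0" if no: "\<nexists>n. b = a + sum_list w + K * n"
        proof -
          have "\<nexists>n. b = a + sum_list ?u + K * n" using no unfolding shift by blast
          moreover have "\<nexists>n. b = Suc a + sum_list w' + K * n" using no sw by simp
          ultimately show ?thesis using IHu(2) IH1(2) cd by simp
        qed
        show ?thesis using 1 2 finite_forests[of k a b w] unfolding K_def by auto
      next
        case False
        then have "sum_list ?u = sum_list w" using c Cons k by (auto simp: sum_list_replicate)
        moreover have "card (forests k a b w) = card (forests k a b ?u)"
          using card_forests_Cons[OF ab k c, of w'] Cons False by simp
        ultimately show ?thesis using IHu finite_forests[of k a b w] unfolding K_def[symmetric] by auto
      qed
    qed
  qed
qed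

section \<open>Rainbow faces\<close>

text \<open>
  A walk with steps \<open>1\<close> and \<open>-1\<close> that turns round revisits a residue two steps later.
\<close>
lemma steps_two_way_constant:
  fixes k :: nat
  assumes "k \<ge> 3" "sorted_wrt (<) xs" "set (steps k xs) \<subseteq> {1, k - 1}"
    "inj_on (\<lambda>l. l mod k) (set xs)" "length xs \<ge> 2"
  shows "\<exists>c\<in>{1, k - 1}. steps k xs = replicate (length xs - 1) c"
  using assms(2-5)
proof (induction xs rule: induct_list012)
  case (3 x y zs)
  show ?case
  proof (cases zs)
    case Nil
    then show ?thesis using "3.prems"(2) by simp
  next
    case (Cons z ws)
    have srt: "sorted_wrt (<) (y # zs)" "set (steps k (y # zs)) \<subseteq> {1, k - 1}"
        "inj_on (\<lambda>l. l mod k) (set (y # zs))" "length (y # zs) \<ge> 2"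
      using "3.prems"(1,2) inj_on_subset[OF "3.prems"(3)] Cons by auto
    obtain c where c: "c \<in> {1, k - 1}" "steps k (y # zs) = replicate (length (y # zs) - 1) c"
      using "3.IH"(2)[OF srt] by blast
    have yz: "(z - y) mod k = c" using c(2) Cons by simp
    have xy: "(y - x) mod k \<in> {1, k - 1}" using "3.prems"(2) by simp
    have lt: "x < y" "y < z" using "3.prems"(1) Cons by auto
    \<comment> \<open>Opposite steps cancel, which would make \<open>x\<close> and \<open>z\<close> congruent.\<close>
    have "(y - x) mod k = c"
    proof (rule ccontr)
      assume "(y - x) mod k \<noteq> c"
      then have "(y - x) mod k \<noteq> (z - y) mod k" unfolding yz .
      moreover have "p + q = k" if "p \<in> {1, k - 1}" "q \<in> {1, k - 1}" "p \<noteq> q" for p q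
        using that assms(1) by auto
      ultimately have full: "(y - x) mod k + (z - y) mod k = k"
        using xy c(1) unfolding yz by blast
      have "z mod k = (x + ((y - x) + (z - y))) mod k" using lt by simp
      also have "\<dots> = (x + ((y - x) mod k + (z - y) mod k)) mod k" by (rule mod_add_cong[OF refl mod_add_eq[symmetric]])
      also have "\<dots> = x mod k" unfolding full by simp
      finally have "z mod k = x mod k" .
      then have "z = x" using inj_onD[OF "3.prems"(3), of z x] Cons by simp
      then show False using lt by simp
    qed
    then have "steps k (x # y # zs) = replicate (length (x # y # zs) - 1) c" using c(2) Cons by simp
    then show ?thesis using c(1) by blast
  qed
qed simp_all

text \<open>
  Conversely, a walk of fewer than \<open>k\<close> equal steps \<open>c\<close> meets distinct residues, since \<open>c\<close> is a unit modulo \<open>k\<close>.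
\<close>
lemma steps_constant_inj:
  fixes k :: nat
  assumes "k \<ge> 2" "c \<in> {1, k - 1}" "sorted_wrt (<) xs" "steps k xs = replicate (length xs - 1) c" "length xs \<le> k"
  shows "inj_on (\<lambda>l. l mod k) (set xs)"
proof -
  have diff: "(xs ! t - xs ! s) mod k = ((t - s) * c) mod k \<and> xs ! s \<le> xs ! t" if "s \<le> t" "t < length xs" for s t
    using that
  proof (induction t rule: dec_induct)
    case (step t)
    have st: "steps k xs ! t = (xs ! Suc t - xs ! t) mod k" if "Suc t < length xs" for xs t
      using that
    proof (induction k xs arbitrary: t rule: steps.induct)
      case (1 k x y zs)
      then show ?case by (cases t) auto
    qed auto
    have stepc: "(xs ! Suc t - xs ! t) mod k = c" using st[OF step.prems] assms(4) step.prems by simp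
    have lt: "xs ! t < xs ! Suc t" using sorted_wrt_nth_less[OF assms(3)] step.prems by simp
    have IH: "(xs ! t - xs ! s) mod k = ((t - s) * c) mod k" "xs ! s \<le> xs ! t"
      using step by auto
    have "xs ! Suc t - xs ! s = (xs ! Suc t - xs ! t) + (xs ! t - xs ! s)"
      using lt IH(2) by simp
    moreover have "(Suc t - s) * c = c + (t - s) * c" using step.hyps by (simp add: Suc_diff_le)
    moreover have "((xs ! Suc t - xs ! t) + (xs ! t - xs ! s)) mod k = (c + (t - s) * c) mod k"
      by (rule mod_add_cong) (use stepc IH(1) in auto)
    ultimately show ?case using lt IH(2) by simp
  qed simp
  have le: "s = t" if "s \<le> t" "t < length xs" "xs ! s mod k = xs ! t mod k" for s t
  proof -
    have "k dvd xs ! t - xs ! s"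
      using that(3) diff[OF that(1,2)] mod_eq_dvd_iff_nat[of "xs ! s" "xs ! t" k] by simp
    then have "k dvd (t - s) * c" using diff[OF that(1,2)] by (simp add: dvd_eq_mod_eq_0)
    moreover have "coprime k c" using assms(1,2) coprime_diff_one_right_nat[of k] by auto
    ultimately have "k dvd t - s" by (simp add: coprime_dvd_mult_left_iff)
    moreover have "t - s < k" using that(2) assms(5) by simp
    ultimately show ?thesis using that(1) nat_dvd_not_less[of "t - s" k] by linarith
  qed
  have "s = t" if "s < length xs" "t < length xs" "xs ! s mod k = xs ! t mod k" for s t
    using le[of s t] le[of t s] that by linarith
  then show ?thesis unfolding inj_on_def by (metis in_set_conv_nth)
qed

lemma colour_image_iff:
  assumes "finite S" "card S = k" "k \<ge> 1"
  shows "colour k ` S = {1..k} \<longleftrightarrow> inj_on (\<lambda>l. l mod k) S"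
proof -
  have sub: "colour k ` S \<subseteq> {1..k}" using assms(3) by (auto simp: colour_def Suc_le_eq)
  have "colour k ` S = {1..k} \<longleftrightarrow> card (colour k ` S) = card S"
    using card_subset_eq[OF _ sub] assms by auto
  also have "\<dots> \<longleftrightarrow> inj_on (colour k) S" using assms(1) by (metis card_image eq_card_imp_inj_on)
  also have "\<dots> \<longleftrightarrow> inj_on (\<lambda>l. l mod k) S" by (simp add: inj_on_def colour_def)
  finally show ?thesis .
qed

lemma balanced_residue:
  assumes "balanced k E" "(i, j) \<in> E" "i < j" "k \<ge> 2"
  shows "(j - i) mod k \<in> {1, k - 1}"
proof -
  obtain c where c: "c \<in> {1, k - 1}" "steps k (sorted_list_of_set (exposed i j (E - {(i, j)}))) = replicate (k - 1) c"
    using assms(1,2) unfolding balanced_def face_def by force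
  show ?thesis using residue_of_run[OF assms(4) c(1) assms(3) c(2)] c(1) assms(4) by auto
qed

text \<open>
  That every edge of a rainbow face has step \<open>1\<close> or \<open>-1\<close> is proved by induction on the length of the arc:
  a lower edge is a unit interval or a shorter arc, whose own face is then balanced.
\<close>
lemma rainbow_faces_iff_balanced:
  assumes "k \<ge> 3" "E \<subseteq> arcs a b" "noncrossing E"
  shows "(\<forall>e\<in>E. card (face E e) = k \<and> colour k ` face E e = {1..k}) \<longleftrightarrow> balanced k E"
proof
  assume bal: "balanced k E"
  show "\<forall>e\<in>E. card (face E e) = k \<and> colour k ` face E e = {1..k}"
  proof
    fix e assume e: "e \<in> E"
    have fin: "finite (face E e)" unfolding face_def by simp
    define xs where "xs = sorted_list_of_set (face E e)"
    obtain c where c: "c \<in> {1, k - 1}" "steps k xs = replicate (k - 1) c"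
      using bal e unfolding balanced_def xs_def by blast
    have "length xs - 1 = k - 1" using arg_cong[OF c(2), of length] by (simp add: length_steps)
    then have len: "length xs = k" using assms(1) by simp
    then have card: "card (face E e) = k" unfolding xs_def by simp
    have "inj_on (\<lambda>l. l mod k) (set xs)"
      by (rule steps_constant_inj[OF _ c(1)]) (use assms(1) c(2) len in \<open>auto simp: xs_def\<close>)
    then show "card (face E e) = k \<and> colour k ` face E e = {1..k}"
      using colour_image_iff[OF fin card] card assms(1) fin unfolding xs_def by simp
  qed
next
  assume rainbow: "\<forall>e\<in>E. card (face E e) = k \<and> colour k ` face E e = {1..k}"
  have "\<exists>c\<in>{1, k - 1}. steps k (sorted_list_of_set (face E (i, j))) = replicate (k - 1) c" if "(i, j) \<in> E" for i j
    using that
  proof (induction "j - i" arbitrary: i j rule: less_induct)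
    case less
    let ?X = "exposed i j (E - {(i, j)})"
    have X: "face E (i, j) = ?X" unfolding face_def by simp
    have ij: "i + 2 \<le> j" using less.prems assms(2) by (auto simp: arcs_def)
    define xs where "xs = sorted_list_of_set ?X"
    have srt: "sorted_wrt (<) xs" and set: "set xs = ?X" unfolding xs_def by auto
    have card: "card ?X = k" "colour k ` ?X = {1..k}" using rainbow less.prems X by auto
    then have len: "length xs = k" unfolding xs_def by simp
    have "inj_on (\<lambda>l. l mod k) (set xs)" using colour_image_iff[of ?X k] card assms(1) set by simp
    moreover have "set (steps k xs) \<subseteq> {1, k - 1}"
    proof -
      have "(y - x) mod k \<in> {1, k - 1}" if adj: "xs = us @ x # y # ws" for us x y ws
      proof -
        have xy: "x \<in> ?X" "y \<in> ?X" "x < y" using set srt adj by (auto simp: sorted_wrt_append)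
        have "False" if l: "l \<in> ?X" "x < l" "l < y" for l
        proof -
          have "l \<in> set (us @ x # y # ws)" using l(1) set adj by simp
          then show False using srt l(2,3) unfolding adj by (auto simp: sorted_wrt_append)
        qed
        then have "y = Suc x \<or> (x, y) \<in> E - {(i, j)}"
          using exposed_adjacent[OF noncrossing_subset[OF assms(3)] xy] by blast
        then show ?thesis
        proof
          assume "y = Suc x"
          then show ?thesis using assms(1) by simp
        next
          assume arc: "(x, y) \<in> E - {(i, j)}"
          have "i \<le> x" "y \<le> j" using xy by (auto simp: exposed_iff)
          then have "y - x < j - i" using arc xy(3) by auto
          then obtain c where c: "c \<in> {1, k - 1}" "steps k (sorted_list_of_set (face E (x, y))) = replicate (k - 1) c"
            using less.hyps arc by blast
          have "(y - x) mod k = k - c"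
            by (rule residue_of_run[OF _ c(1) xy(3)]) (use assms(1) c(2) in \<open>auto simp: face_def\<close>)
          then show ?thesis using c(1) assms(1) by auto
        qed
      qed
      moreover have "\<exists>us x y ws. xs = us @ x # y # ws \<and> d = (y - x) mod k" if "d \<in> set (steps k xs)" for d xs
        using that
      proof (induction k xs rule: steps.induct)
        case (1 k x y zs)
        show ?case
        proof (cases "d = (y - x) mod k")
          case True
          then show ?thesis by (metis append_Nil)
        next
          case False
          then obtain us x' y' ws where "y # zs = us @ x' # y' # ws" "d = (y' - x') mod k"
            using 1 by auto
          then have "x # y # zs = (x # us) @ x' # y' # ws" by simp
          then show ?thesis using \<open>d = (y' - x') mod k\<close> by blast
        qed
      qed auto
      ultimately show ?thesis by blast
    qed
    ultimately show ?case
      using steps_two_way_constant[OF assms(1) srt] len assms(1) X unfolding xs_def by auto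
  qed
  then show "balanced k E" unfolding balanced_def by auto
qed

section \<open>Orientation and convex polygons\<close>

text \<open>
  Twice the signed area of the triangle \<open>x y z\<close>. Since it is an affine function of \<open>z\<close>, its sign tells on
  which side of the line through \<open>x\<close> and \<open>y\<close> the point \<open>z\<close> lies.
\<close>
definition orient :: "complex \<Rightarrow> complex \<Rightarrow> complex \<Rightarrow> real" where
  "orient x y z = Im (cnj (y - x) * (z - x))"

lemma orient_inner: "orient x y z = (\<i> * (y - x)) \<bullet> z - (\<i> * (y - x)) \<bullet> x"
  by (simp add: orient_def inner_complex_def algebra_simps)

lemma orient_same [simp]: "orient x y x = 0" "orient x y y = 0" "orient x x y = 0"
  by (simp_all add: orient_def algebra_simps)

lemma orient_rotate: "orient y z x = orient x y z"
  by (simp add: orient_def algebra_simps)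

lemma orient_swap: "orient y x z = - orient x y z"
  by (simp add: orient_def algebra_simps)

lemma orient_combination:
  "u + w = 1 \<Longrightarrow> orient x y (u *\<^sub>R p + w *\<^sub>R q) = u * orient x y p + w * orient x y q"
  unfolding orient_inner by (auto simp: inner_add_right algebra_simps simp flip: distrib_right)

lemma orient_sum:
  assumes "finite S" "sum u S = 1"
  shows "orient x y (\<Sum>p\<in>S. u p *\<^sub>R p) = (\<Sum>p\<in>S. u p * orient x y p)"
proof -
  have "(\<Sum>p\<in>S. u p * orient x y p) = (\<Sum>p\<in>S. u p * ((\<i> * (y - x)) \<bullet> p)) - sum u S * ((\<i> * (y - x)) \<bullet> x)"
    unfolding orient_inner by (simp add: right_diff_distrib sum_subtractf sum_distrib_right)
  then show ?thesis unfolding orient_inner assms(2) by (simp add: inner_sum_right)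
qed

lemma orient_nonneg_hull: "z \<in> convex hull S \<Longrightarrow> (\<And>p. p \<in> S \<Longrightarrow> 0 \<le> orient x y p) \<Longrightarrow> 0 \<le> orient x y z"
proof -
  assume *: "z \<in> convex hull S" "\<And>p. p \<in> S \<Longrightarrow> 0 \<le> orient x y p"
  have "{z. 0 \<le> orient x y z} = {z. (\<i> * (y - x)) \<bullet> z \<ge> (\<i> * (y - x)) \<bullet> x}"
    unfolding orient_inner by auto
  then have "convex {z. 0 \<le> orient x y z}" by (simp add: convex_halfspace_ge)
  then have "convex hull S \<subseteq> {z. 0 \<le> orient x y z}" using *(2) by (intro hull_minimal) auto
  then show ?thesis using *(1) by blast
qed

lemma orient_pos_interior_hull:
  assumes "z \<in> interior (convex hull S)" "\<And>p. p \<in> S \<Longrightarrow> 0 \<le> orient x y p" "x \<noteq> y"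
  shows "0 < orient x y z"
proof -
  have "convex hull S \<subseteq> {z. (\<i> * (y - x)) \<bullet> z \<ge> (\<i> * (y - x)) \<bullet> x}"
    using orient_nonneg_hull[OF _ assms(2)] unfolding orient_inner by auto
  then have "z \<in> interior {z. (\<i> * (y - x)) \<bullet> z \<ge> (\<i> * (y - x)) \<bullet> x}"
    using assms(1) interior_mono by blast
  then show ?thesis using assms(3) by (simp add: orient_inner)
qed

text \<open>
  A supporting line meets the convex hull in the hull of the points that it contains: in a convex
  combination on the line the other points must have weight zero.
\<close>
lemma hull_orient_zero:
  assumes "finite S" "z \<in> convex hull S" "\<And>p. p \<in> S \<Longrightarrow> 0 \<le> orient x y p" "orient x y z = 0"
  shows "z \<in> convex hull {p \<in> S. orient x y p = 0}"
proof -
  obtain u where u: "\<forall>p\<in>S. 0 \<le> u p" "sum u S = 1" "(\<Sum>p\<in>S. u p *\<^sub>R p) = z"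
    using assms(2) unfolding convex_hull_finite[OF assms(1)] by blast
  have "(\<Sum>p\<in>S. u p * orient x y p) = 0" using orient_sum[OF assms(1) u(2), of x y] u(3) assms(4) by simp
  then have "\<forall>p\<in>S. u p * orient x y p = 0"
    using sum_nonneg_eq_0_iff[OF assms(1), of "\<lambda>p. u p * orient x y p"] u(1) assms(3) by simp
  then have off: "\<And>p. p \<in> S - {p \<in> S. orient x y p = 0} \<Longrightarrow> u p = 0" by auto
  let ?T = "{p \<in> S. orient x y p = 0}"
  have "sum u ?T = 1" using sum.mono_neutral_left[OF assms(1), of ?T u] off u(2) by auto
  moreover have "(\<Sum>p\<in>?T. u p *\<^sub>R p) = z"
    using sum.mono_neutral_left[OF assms(1), of ?T "\<lambda>p. u p *\<^sub>R p"] off u(3) by auto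
  moreover have "finite ?T" using assms(1) by simp
  ultimately show ?thesis unfolding convex_hull_finite[OF \<open>finite ?T\<close>] using u(1) by auto
qed

lemma orient_segment: "z \<in> closed_segment x y \<Longrightarrow> orient x y z = 0"
proof -
  assume "z \<in> closed_segment x y"
  then obtain u where "z = (1 - u) *\<^sub>R x + u *\<^sub>R y" by (auto simp: in_segment)
  then show ?thesis using orient_combination[of "1 - u" u x y x y] by simp
qed

text \<open>
  The three orientations are the barycentric coordinates of \<open>z\<close> up to the factor \<open>orient a b c\<close>.
\<close>
lemma triangle_hull:
  assumes "0 < orient a b c" "0 \<le> orient a b z" "0 \<le> orient b c z" "orient a c z \<le> 0"
  shows "z \<in> convex hull {a, b, c}"
proof -
  define D where "D = orient a b c"
  have z: "D *\<^sub>R z = orient b c z *\<^sub>R a + (- orient a c z) *\<^sub>R b + orient a b z *\<^sub>R c"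
    unfolding D_def orient_def by (simp add: complex_eq_iff algebra_simps)
  have s: "orient b c z + - orient a c z + orient a b z = D"
    unfolding D_def orient_def by (simp add: algebra_simps)
  have "z = (1 / D) *\<^sub>R (D *\<^sub>R z)" using assms(1) unfolding D_def by simp
  also have "\<dots> = (orient b c z / D) *\<^sub>R a + (- orient a c z / D) *\<^sub>R b + (orient a b z / D) *\<^sub>R c"
    unfolding z by (simp add: scaleR_add_right scaleR_diff_right divide_inverse mult.commute)
  finally have zz: "z = (orient b c z / D) *\<^sub>R a + (- orient a c z / D) *\<^sub>R b + (orient a b z / D) *\<^sub>R c" .
  have "orient b c z / D + - orient a c z / D + orient a b z / D = 1"
    using s assms(1) unfolding D_def by (simp add: field_simps)
  moreover have "0 \<le> orient b c z / D" "0 \<le> - orient a c z / D" "0 \<le> orient a b z / D"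
    using assms unfolding D_def by (simp_all add: divide_nonpos_pos)
  ultimately show ?thesis unfolding convex_hull_3 using zz by blast
qed

text \<open>
  The last condition is the one for the closing edge, which runs from \<open>v (m - 1)\<close> to \<open>v 0\<close>; hence the
  opposite sign.
\<close>
definition inside_polygon :: "nat \<Rightarrow> (nat \<Rightarrow> complex) \<Rightarrow> complex \<Rightarrow> bool" where
  "inside_polygon m v z \<longleftrightarrow>
     (\<forall>l. Suc l < m \<longrightarrow> 0 < orient (v l) (v (Suc l)) z) \<and> orient (v 0) (v (m - 1)) z < 0"

lemma convex_polygon_orient:
  "convex_polygon m v \<longleftrightarrow> inj_on v {..<m} \<and>
     (\<forall>i j l. i < j \<and> j < l \<and> l < m \<longrightarrow> 0 < orient (v i) (v j) (v l))"
  by (simp add: convex_polygon_def orient_def)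

lemma convex_polygon_subpolygon:
  assumes "convex_polygon m v" "\<And>i j. i < j \<Longrightarrow> j < n \<Longrightarrow> f i < f j" "\<And>i. i < n \<Longrightarrow> f i < m"
  shows "convex_polygon n (v \<circ> f)"
proof -
  have "inj_on f {..<n}" 
    using assms(2) by (intro inj_onI) (metis lessThan_iff less_irrefl linorder_neqE_nat)
  moreover have "f ` {..<n} \<subseteq> {..<m}" using assms(3) by auto
  ultimately have "inj_on (v \<circ> f) {..<n}"
    using assms(1) by (meson comp_inj_on convex_polygon_def inj_on_subset)
  then show ?thesis using assms unfolding convex_polygon_orient by (metis comp_apply order.strict_trans)
qed

text \<open>
  Induction on the number of vertices: the diagonal cutting off the last vertex leaves \<open>z\<close> in the triangle
  at that vertex or in the smaller polygon.
\<close>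
lemma polygon_halfplanes_hull:
  assumes "convex_polygon m v" "m \<ge> 3"
    "\<And>l. Suc l < m \<Longrightarrow> 0 \<le> orient (v l) (v (Suc l)) z" "orient (v 0) (v (m - 1)) z \<le> 0"
  shows "z \<in> convex hull (v ` {..<m})"
  using assms(2,1,3,4)
proof (induction m rule: dec_induct)
  case base
  then have "z \<in> convex hull {v 0, v 1, v 2}"
    by (intro triangle_hull) (auto simp: convex_polygon_orient numeral_2_eq_2 numeral_3_eq_3)
  moreover have "v ` {..<3} = {v 0, v 1, v 2}" by (auto simp: numeral_2_eq_2 numeral_3_eq_3 lessThan_Suc)
  ultimately show ?case by simp
next
  case (step n)
  show ?case
  proof (cases "orient (v 0) (v (n - 1)) z \<le> 0")
    case True
    have "convex_polygon n v"
      using step.prems(1) unfolding convex_polygon_orient by (auto intro: inj_on_subset)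
    then have "z \<in> convex hull (v ` {..<n})" using step True by auto
    then show ?thesis using hull_mono[of "v ` {..<n}" "v ` {..<Suc n}" convex] by (auto simp: image_mono)
  next
    case False
    have n: "Suc (n - 1) = n" using step.hyps by simp
    have "z \<in> convex hull {v 0, v (n - 1), v n}"
    proof (rule triangle_hull)
      show "0 < orient (v 0) (v (n - 1)) (v n)"
        using step.prems(1) step.hyps unfolding convex_polygon_orient by auto
      show "0 \<le> orient (v (n - 1)) (v n) z" using step.prems(2)[of "n - 1"] n by simp
    qed (use False step.prems in auto)
    moreover have "{v 0, v (n - 1), v n} \<subseteq> v ` {..<Suc n}" using step.hyps by auto
    ultimately show ?thesis using hull_mono by blast
  qed
qed

lemma open_inside_polygon: "open {z. inside_polygon m v z}"
proof -
  have gt: "open {z. 0 < orient x y z}" for x y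
    using open_halfspace_gt[of "(\<i> * (y - x)) \<bullet> x" "\<i> * (y - x)"] unfolding orient_inner by (simp add: algebra_simps)
  have "{z. inside_polygon m v z} = (\<Inter>l\<in>{l. Suc l < m}. {z. 0 < orient (v l) (v (Suc l)) z}) \<inter>
      {z. 0 < orient (v (m - 1)) (v 0) z}"
    unfolding inside_polygon_def orient_swap[of "v (m - 1)" "v 0"] by auto
  moreover have "finite {l. Suc l < m}" by (rule finite_subset[of _ "{..<m}"]) auto
  ultimately show ?thesis using gt by (auto intro!: open_INT)
qed

lemma inside_polygon_interior:
  assumes "convex_polygon m v" "m \<ge> 3" "inside_polygon m v z"
  shows "z \<in> interior (convex hull (v ` {..<m}))"
proof (rule interiorI[OF open_inside_polygon])
  show "z \<in> {z. inside_polygon m v z}" using assms by simp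
  show "{z. inside_polygon m v z} \<subseteq> convex hull (v ` {..<m})"
    using polygon_halfplanes_hull[OF assms(1,2)] by (auto simp: inside_polygon_def less_imp_le)
qed

context
  fixes m :: nat and v :: "nat \<Rightarrow> complex"
  assumes polygon: "convex_polygon m v"
begin

abbreviation chord :: "nat \<times> nat \<Rightarrow> complex set" where
  "chord e \<equiv> closed_segment (v (fst e)) (v (snd e))"

abbreviation region :: "nat set \<Rightarrow> complex set" where
  "region S \<equiv> interior (convex hull (v ` S))"

lemma vertex_eq_iff: "i < m \<Longrightarrow> j < m \<Longrightarrow> v i = v j \<longleftrightarrow> i = j"
  using polygon unfolding convex_polygon_def by (auto dest: inj_onD)

lemma orient_left:
  assumes "i < j" "j < m" "l < m" "l < i \<or> j < l"
  shows "0 < orient (v i) (v j) (v l)"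
proof (cases "l < i")
  case True
  then have "0 < orient (v l) (v i) (v j)" using assms polygon unfolding convex_polygon_orient by blast
  then show ?thesis by (metis orient_rotate)
next
  case False
  then show ?thesis using assms polygon unfolding convex_polygon_orient by blast
qed

lemma orient_right:
  assumes "i < l" "l < j" "j < m"
  shows "orient (v i) (v j) (v l) < 0"
proof -
  have "orient (v i) (v j) (v l) = - orient (v i) (v l) (v j)"
    by (metis orient_rotate orient_swap)
  then show ?thesis using assms polygon unfolding convex_polygon_orient by simp
qed

lemma orient_left_weak:
  assumes "i < j" "j < m" "l < m" "l \<le> i \<or> j \<le> l"
  shows "0 \<le> orient (v i) (v j) (v l)"
  using orient_left[OF assms(1-3)] assms(4) by (cases "l = i \<or> l = j") auto

lemma orient_right_weak:
  assumes "i \<le> l" "l \<le> j" "j < m"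
  shows "orient (v i) (v j) (v l) \<le> 0"
  using orient_right[of i l j] assms by (cases "l = i \<or> l = j") auto

lemma region_left:
  assumes "z \<in> region S" "S \<subseteq> {..<m}" "i < j" "j < m" "\<And>l. l \<in> S \<Longrightarrow> l \<le> i \<or> j \<le> l"
  shows "0 < orient (v i) (v j) z"
  by (rule orient_pos_interior_hull[OF assms(1)])
    (use assms orient_left_weak[OF assms(3,4)] vertex_eq_iff[of i j] in auto)

lemma region_right:
  assumes "z \<in> region S" "S \<subseteq> {i..j}" "i < j" "j < m"
  shows "orient (v i) (v j) z < 0"
proof -
  have "0 \<le> orient (v j) (v i) (v l)" if "l \<in> S" for l
    unfolding orient_swap[of "v j"] using orient_right_weak[of i l j] assms that by auto
  then have "0 < orient (v j) (v i) z"
    using orient_pos_interior_hull[OF assms(1), of "v j" "v i"] vertex_eq_iff[of i j] assms by auto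
  then show ?thesis by (simp add: orient_swap[of "v j"])
qed

text \<open>
  If all chosen vertices lie on one side of a chord, the chord supports their hull. Keeping track of
  which endpoints are chosen makes the statement sharp enough to show that touching chords meet only
  in vertices.
\<close>
lemma hull_on_chord:
  assumes "z \<in> convex hull (v ` S)" "S \<subseteq> {..<m}" "i < j" "j < m" "orient (v i) (v j) z = 0"
    "S \<subseteq> {i..j} \<or> (\<forall>l\<in>S. l \<le> i \<or> j \<le> l)"
  shows "z \<in> convex hull {p. (p = v i \<and> i \<in> S) \<or> (p = v j \<and> j \<in> S)}"
proof -
  have fin: "finite (v ` S)" using assms(2) finite_subset by blast
  have zero: "{p \<in> v ` S. orient (v i) (v j) p = 0} \<subseteq> {p. (p = v i \<and> i \<in> S) \<or> (p = v j \<and> j \<in> S)}"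
  proof
    fix p assume "p \<in> {p \<in> v ` S. orient (v i) (v j) p = 0}"
    then obtain l where l: "l \<in> S" "p = v l" "orient (v i) (v j) (v l) = 0" by blast
    have "l = i \<or> l = j"
    proof (rule ccontr)
      assume "\<not> (l = i \<or> l = j)"
      then consider "l < i \<or> j < l" | "i < l" "l < j" by linarith
      then show False
      proof cases
        case 1
        then show False using orient_left[of i j l] l assms(2-4) by auto
      next
        case 2
        then show False using orient_right[of i l j] l assms(4) by auto
      qed
    qed
    then show "p \<in> {p. (p = v i \<and> i \<in> S) \<or> (p = v j \<and> j \<in> S)}" using l by auto
  qed
  have "z \<in> convex hull {p \<in> v ` S. orient (v i) (v j) p = 0}"
    using assms(6)
  proof
    assume "\<forall>l\<in>S. l \<le> i \<or> j \<le> l"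
    then show ?thesis
      by (intro hull_orient_zero[OF fin assms(1) _ assms(5)])
        (use orient_left_weak[OF assms(3,4)] assms(2) in auto)
  next
    assume S: "S \<subseteq> {i..j}"
    have "{p \<in> v ` S. orient (v i) (v j) p = 0} = {p \<in> v ` S. orient (v j) (v i) p = 0}"
      by (simp add: orient_swap[of "v j"])
    moreover have "z \<in> convex hull {p \<in> v ` S. orient (v j) (v i) p = 0}"
      by (rule hull_orient_zero[OF fin assms(1)])
        (use orient_right_weak[of i _ j] assms S in \<open>auto simp: orient_swap[of "v j"]\<close>)
    ultimately show ?thesis by simp
  qed
  then show ?thesis using hull_mono[OF zero] by blast
qed

lemma hull_on_chord_segment:
  assumes "z \<in> convex hull (v ` S)" "S \<subseteq> {..<m}" "i < j" "j < m" "orient (v i) (v j) z = 0"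
    "S \<subseteq> {i..j} \<or> (\<forall>l\<in>S. l \<le> i \<or> j \<le> l)"
  shows "z \<in> chord (i, j)"
proof -
  have "{p. (p = v i \<and> i \<in> S) \<or> (p = v j \<and> j \<in> S)} \<subseteq> {v i, v j}" by auto
  then have "z \<in> convex hull {v i, v j}" using hull_on_chord[OF assms] hull_mono by blast
  then show ?thesis by (simp add: segment_convex_hull)
qed

text \<open>
  An edge of the polygon at the vertex supports the hull of the remaining vertices and meets it at most
  in its other endpoint.
\<close>
lemma vertex_notin_hull:
  assumes "S \<subseteq> {..<m}" "i < m" "i \<notin> S" "m \<ge> 2"
  shows "v i \<notin> convex hull (v ` S)"
proof
  assume z: "v i \<in> convex hull (v ` S)"
  show False
  proof (cases "Suc i < m")
    case True
    have "v i \<in> convex hull {p. (p = v i \<and> i \<in> S) \<or> (p = v (Suc i) \<and> Suc i \<in> S)}"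
      by (rule hull_on_chord[OF z assms(1)]) (use True in auto)
    moreover have "{p. (p = v i \<and> i \<in> S) \<or> (p = v (Suc i) \<and> Suc i \<in> S)} \<subseteq> {v (Suc i)}" using assms(3) by auto
    ultimately have "v i \<in> convex hull {v (Suc i)}" using hull_mono by blast
    then show False using vertex_eq_iff[OF assms(2) True] by simp
  next
    case False
    then have i: "i = m - 1" using assms(2) by simp
    have "v i \<in> convex hull {p. (p = v 0 \<and> 0 \<in> S) \<or> (p = v i \<and> i \<in> S)}"
      by (rule hull_on_chord[OF z assms(1)]) (use i assms in auto)
    moreover have "{p. (p = v 0 \<and> 0 \<in> S) \<or> (p = v i \<and> i \<in> S)} \<subseteq> {v 0}" using assms(3) by auto
    ultimately have "v i \<in> convex hull {v 0}" using hull_mono by blast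
    then show False using vertex_eq_iff[OF assms(2), of 0] i assms by simp
  qed
qed

lemma vertex_notin_region:
  assumes "i < m" "m \<ge> 2"
  shows "v i \<notin> region {..<m}"
proof (cases "Suc i < m")
  case True
  have "0 < orient (v i) (v (Suc i)) (v i)" if "v i \<in> region {..<m}"
    by (rule region_left[OF that]) (use True in auto)
  then show ?thesis by auto
next
  case False
  then have "i = m - 1" using assms(1) by simp
  have "orient (v 0) (v i) (v i) < 0" if "v i \<in> region {..<m}"
    by (rule region_right[OF that]) (use \<open>i = m - 1\<close> assms in auto)
  then show ?thesis by auto
qed

lemma strict_sorted_subpolygon:
  assumes "sorted_wrt (<) xs" "set xs \<subseteq> {..<m}"
  shows "convex_polygon (length xs) (v \<circ> nth xs)"
  by (rule convex_polygon_subpolygon[OF polygon]) (use assms nth_mem in \<open>fastforce simp: sorted_wrt_iff_nth_less\<close>)+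

lemma image_nth: "(v \<circ> nth xs) ` {..<length xs} = v ` set xs"
  unfolding image_comp[symmetric] by (auto simp: set_conv_nth)

text \<open>
  The centroid of any three of the vertices is an interior point.
\<close>
lemma region_nonempty:
  assumes "S \<subseteq> {..<m}" "card S \<ge> 3"
  shows "region S \<noteq> {}"
proof -
  obtain T where "T \<subseteq> S" "card T = 3" "finite T"
    using obtain_subset_with_card_n[OF assms(2)] by metis
  define xs where "xs = sorted_list_of_set T"
  have xs: "sorted_wrt (<) xs" "set xs = T" "length xs = 3"
    unfolding xs_def using \<open>card T = 3\<close> \<open>finite T\<close> by auto
  define w where "w = v \<circ> nth xs"
  have w: "convex_polygon 3 w" using strict_sorted_subpolygon[of xs] xs \<open>T \<subseteq> S\<close> assms(1) unfolding w_def by auto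
  define z where "z = (1/3) *\<^sub>R (w 0 + w 1 + w 2)"
  have D: "0 < orient (w 0) (w 1) (w 2)" using w unfolding convex_polygon_orient by auto
  have "orient (w 0) (w 1) z = orient (w 0) (w 1) (w 2) / 3"
    "orient (w 1) (w 2) z = orient (w 0) (w 1) (w 2) / 3"
    "orient (w 0) (w 2) z = - orient (w 0) (w 1) (w 2) / 3"
    unfolding z_def orient_def by (auto simp: algebra_simps)
  then have "0 < orient (w l) (w (Suc l)) z" if "l = 0 \<or> l = 1" for l
    using that D by (auto simp: numeral_2_eq_2)
  moreover have "l = 0 \<or> l = 1" if "Suc l < 3" for l :: nat using that by linarith
  ultimately have "inside_polygon 3 w z" using D \<open>orient (w 0) (w 2) z = _\<close>
    unfolding inside_polygon_def by auto
  then have "z \<in> interior (convex hull (w ` {..<3}))" using inside_polygon_interior[OF w] by simp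
  moreover have "w ` {..<3} = v ` T" using image_nth[of xs] xs unfolding w_def by simp
  moreover have "interior (convex hull (v ` T)) \<subseteq> region S"
    using \<open>T \<subseteq> S\<close> by (intro interior_mono hull_mono) auto
  ultimately show ?thesis by auto
qed

text \<open>
  The closure of the region is the whole hull, and the hull contains exactly the chosen vertices. Hence
  the vertex set of a region is well defined.
\<close>
lemma region_eq_iff:
  assumes "S \<subseteq> {..<m}" "card S \<ge> 3" "T \<subseteq> {..<m}" "card T \<ge> 3"
  shows "region S = region T \<longleftrightarrow> S = T"
proof
  assume eq: "region S = region T"
  have fin: "finite S" "finite T" using assms finite_subset by blast+
  have "m \<ge> 2" using card_mono[OF _ assms(1)] assms(2) by simp
  have "closure (convex hull (v ` S)) = closure (convex hull (v ` T))"
    using convex_closure_interior[of "convex hull (v ` S)"] convex_closure_interior[of "convex hull (v ` T)"]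
      region_nonempty assms eq by (metis convex_convex_hull)
  then have hull: "convex hull (v ` S) = convex hull (v ` T)"
    using fin by (simp add: compact_imp_closed finite_imp_compact_convex_hull)
  show "S = T"
  proof (rule set_eqI)
    fix i
    have mem: "i \<in> U \<longleftrightarrow> i < m \<and> v i \<in> convex hull (v ` U)" if "U \<subseteq> {..<m}" for U
      using that vertex_notin_hull[OF that _ _ \<open>m \<ge> 2\<close>, of i] by (auto intro: hull_inc)
    show "i \<in> S \<longleftrightarrow> i \<in> T" using mem[OF assms(1)] mem[OF assms(3)] hull by simp
  qed
qed simp


lemma side_in_sides: "Suc l < m \<Longrightarrow> chord (l, Suc l) \<in> sides m v"
  unfolding sides_def by (force intro: exI[of _ l])

lemma top_in_sides: "m \<ge> 2 \<Longrightarrow> chord (0, m - 1) \<in> sides m v"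
  unfolding sides_def by (auto intro!: exI[of _ "m - 1"] simp: closed_segment_commute)

lemma hull_minus_sides_inside:
  assumes "m \<ge> 3" "z \<in> convex hull (v ` {..<m})" "z \<notin> \<Union> (sides m v)"
  shows "inside_polygon m v z"
  unfolding inside_polygon_def
proof (intro conjI allI impI)
  fix l assume l: "Suc l < m"
  have "z \<in> chord (l, Suc l)" if "orient (v l) (v (Suc l)) z = 0"
    by (rule hull_on_chord_segment[OF assms(2)]) (use that l in auto)
  then have "orient (v l) (v (Suc l)) z \<noteq> 0" using side_in_sides[OF l] assms(3) by blast
  moreover have "0 \<le> orient (v l) (v (Suc l)) z"
  proof (rule orient_nonneg_hull[OF assms(2)])
    fix p assume "p \<in> v ` {..<m}"
    then obtain s where "s < m" "p = v s" by blast
    moreover have "s \<le> l \<or> Suc l \<le> s" by linarith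
    ultimately show "0 \<le> orient (v l) (v (Suc l)) p" using orient_left_weak[of l "Suc l" s] l by simp
  qed
  ultimately show "0 < orient (v l) (v (Suc l)) z" by simp
next
  have "z \<in> chord (0, m - 1)" if "orient (v 0) (v (m - 1)) z = 0"
    by (rule hull_on_chord_segment[OF assms(2)]) (use that assms(1) in auto)
  moreover have "chord (0, m - 1) \<in> sides m v" using top_in_sides assms(1) by simp
  ultimately have "orient (v 0) (v (m - 1)) z \<noteq> 0" using assms(3) by blast
  moreover have "0 \<le> orient (v (m - 1)) (v 0) z"
    by (rule orient_nonneg_hull[OF assms(2)])
      (use orient_right_weak[of 0 _ "m - 1"] assms(1) in \<open>auto simp: orient_swap[of "v (m - Suc 0)"]\<close>)
  ultimately show "orient (v 0) (v (m - 1)) z < 0" by (simp add: orient_swap[of "v (m - Suc 0)"])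
qed

text \<open>
  The vertices \<open>i, ..., j\<close> form a convex polygon themselves, bounded by sides of the large polygon and
  the chord.
\<close>
lemma inside_right_of_chord_hull:
  assumes "inside_polygon m v z" "i + 2 \<le> j" "j < m" "orient (v i) (v j) z \<le> 0"
  shows "z \<in> convex hull (v ` {i..j})"
proof -
  define n where "n = Suc (j - i)"
  have "convex_polygon n (v \<circ> (+) i)"
    by (rule convex_polygon_subpolygon[OF polygon]) (use assms in \<open>auto simp: n_def\<close>)
  moreover have "0 \<le> orient ((v \<circ> (+) i) l) ((v \<circ> (+) i) (Suc l)) z" if "Suc l < n" for l
    using assms(1) that assms(2,3) unfolding inside_polygon_def n_def by (auto simp: less_imp_le)
  moreover have "orient ((v \<circ> (+) i) 0) ((v \<circ> (+) i) (n - 1)) z \<le> 0"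
    using assms unfolding n_def by simp
  ultimately have "z \<in> convex hull ((v \<circ> (+) i) ` {..<n})"
    using assms(2) by (intro polygon_halfplanes_hull) (auto simp: n_def)
  moreover have "(+) i ` {..<n} = {i..j}"
  proof
    show "{i..j} \<subseteq> (+) i ` {..<n}"
    proof
      fix x assume "x \<in> {i..j}"
      then have "x = i + (x - i)" "x - i < n" unfolding n_def by auto
      then show "x \<in> (+) i ` {..<n}" by blast
    qed
  qed (use assms(2) in \<open>auto simp: n_def\<close>)
  ultimately show ?thesis by (simp only: image_comp[symmetric])
qed

lemma chord_subset_hull: "i \<in> S \<Longrightarrow> j \<in> S \<Longrightarrow> chord (i, j) \<subseteq> convex hull (v ` S)"
  unfolding segment_convex_hull by (rule hull_mono) auto

text \<open>
  The line through \<open>v i\<close> and \<open>v j\<close> separates \<open>v p\<close> from \<open>v q\<close>, so it divides the segment between these in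
  the ratio of their distances \<open>\<alpha>\<close> and \<open>\<beta>\<close> from it. The point of division lies strictly inside the quadrilateral
  with vertices \<open>i, p, j, q\<close>.
\<close>
lemma crossing_chords_meet:
  assumes "i < p" "p < j" "j < q" "q < m"
  shows "chord (i, j) \<inter> chord (p, q) \<inter> region {..<m} \<noteq> {}"
proof -
  define \<alpha> where "\<alpha> = - orient (v i) (v j) (v p)"
  define \<beta> where "\<beta> = orient (v i) (v j) (v q)"
  have ab: "0 < \<alpha>" "0 < \<beta>"
    using orient_right[of i p j] orient_left[of i j q] assms unfolding \<alpha>_def \<beta>_def by auto
  define u where "u = \<beta> / (\<alpha> + \<beta>)"
  define w where "w = \<alpha> / (\<alpha> + \<beta>)"
  have uw: "0 < u" "0 < w" "u + w = 1" using ab unfolding u_def w_def by (simp_all flip: add_divide_distrib)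
  define z where "z = u *\<^sub>R v p + w *\<^sub>R v q"
  have comb: "orient x y z = u * orient x y (v p) + w * orient x y (v q)" for x y
    unfolding z_def by (rule orient_combination[OF uw(3)])
  have pq: "z \<in> chord (p, q)"
    unfolding z_def using uw by (auto simp: in_segment intro!: exI[of _ w])
  have zij: "orient (v i) (v j) z = 0"
  proof -
    have "orient (v i) (v j) z = u * (- \<alpha>) + w * \<beta>" unfolding comb \<alpha>_def \<beta>_def by simp
    moreover have "u * \<alpha> = w * \<beta>" unfolding u_def w_def by (simp add: mult.commute)
    ultimately show ?thesis by simp
  qed
  have pos: "0 < orient (v i) (v p) z" "0 < orient (v p) (v j) z" "0 < orient (v j) (v q) z"
      "orient (v i) (v q) z < 0"
    unfolding comb using uw orient_left[of i p q] orient_left[of p j q] orient_left[of j q p]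
      orient_right[of i p q] assms by (simp_all add: mult_pos_neg)
  have "z \<in> convex hull {v i, v p, v j}"
    by (rule triangle_hull) (use pos zij orient_left[of i p j] assms in auto)
  then have "z \<in> convex hull (v ` {i, p, j})" by simp
  then have ij: "z \<in> chord (i, j)"
    by (rule hull_on_chord_segment) (use assms zij in auto)
  define xs where "xs = [i, p, j, q]"
  have xs: "sorted_wrt (<) xs" "set xs \<subseteq> {..<m}" "length xs = 4" using assms unfolding xs_def by auto
  have "0 < orient (v (xs ! l)) (v (xs ! Suc l)) z" if "Suc l < 4" for l
  proof -
    have "l = 0 \<or> l = 1 \<or> l = 2" using that by linarith
    then show ?thesis using pos unfolding xs_def by auto
  qed
  then have "inside_polygon 4 (v \<circ> nth xs) z"
    using pos(4) by (simp add: inside_polygon_def xs_def)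
  then have "z \<in> interior (convex hull ((v \<circ> nth xs) ` {..<length xs}))"
    using inside_polygon_interior[OF strict_sorted_subpolygon[OF xs(1,2)]] xs(3) by simp
  then have "z \<in> region (set xs)" unfolding image_nth .
  moreover have "region (set xs) \<subseteq> region {..<m}"
    using xs(2) by (intro interior_mono hull_mono) auto
  ultimately show ?thesis using ij pq by blast
qed

text \<open>
  Each of the two chords supports the other one, so they can only share a vertex of the polygon.
\<close>
lemma noncrossing_chords_disjoint:
  assumes "i < j" "j < m" "p < q" "q < m" "(i, j) \<noteq> (p, q)"
    "\<not> (i < p \<and> p < j \<and> j < q)" "\<not> (p < i \<and> i < q \<and> q < j)"
  shows "chord (i, j) \<inter> chord (p, q) \<inter> region {..<m} = {}"
proof (rule ccontr)
  assume "chord (i, j) \<inter> chord (p, q) \<inter> region {..<m} \<noteq> {}"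
  then obtain z where z: "z \<in> chord (i, j)" "z \<in> chord (p, q)" "z \<in> region {..<m}" by blast
  let ?S = "{p, q}"
  have side: "?S \<subseteq> {i..j} \<or> (\<forall>l\<in>?S. l \<le> i \<or> j \<le> l)" using assms by auto
  have "z \<in> convex hull (v ` ?S)" using z(2) by (simp add: segment_convex_hull)
  moreover have "orient (v i) (v j) z = 0" using orient_segment z(1) by simp
  ultimately have "z \<in> convex hull {x. (x = v i \<and> i \<in> ?S) \<or> (x = v j \<and> j \<in> ?S)}"
    using hull_on_chord[OF _ _ assms(1,2) _ side] assms by auto
  moreover have "\<exists>l<m. {x. (x = v i \<and> i \<in> ?S) \<or> (x = v j \<and> j \<in> ?S)} \<subseteq> {v l}"
  proof (cases "i \<in> ?S")
    case True
    then have "j \<notin> ?S" using assms by auto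
    then show ?thesis using assms by (intro exI[of _ i]) auto
  next
    case False
    then show ?thesis using assms by (intro exI[of _ j]) auto
  qed
  ultimately obtain l where l: "l < m" "z \<in> convex hull {v l}" using hull_mono by blast
  then have "z = v l" by simp
  then show False using vertex_notin_region[OF l(1)] z(3) assms by simp
qed

text \<open>
  From here on the arcs form a noncrossing system that includes the closing edge \<open>(0, m - 1)\<close>.
\<close>
context
  fixes E :: "(nat \<times> nat) set"
  assumes E: "E \<subseteq> arcs 0 (m - 1)" and m: "m \<ge> 3" and top: "(0, m - 1) \<in> E"
    and nc: "noncrossing E"
begin

lemma arc_bounds: "(i, j) \<in> E \<Longrightarrow> i + 2 \<le> j \<and> j < m"
  using E m by (auto simp: arcs_def)

lemma face_subset: "face E (i, j) \<subseteq> {i..j}"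
  unfolding face_def using exposed_subset by simp

lemma face_vertices: "e \<in> E \<Longrightarrow> face E e \<subseteq> {..<m}"
  using arc_bounds[of "fst e" "snd e"] face_subset[of "fst e" "snd e"] by fastforce

lemma card_face: "e \<in> E \<Longrightarrow> card (face E e) \<ge> 3"
proof -
  assume e: "e \<in> E"
  obtain i j where ij: "e = (i, j)" by (cases e)
  have b: "i + 2 \<le> j" using arc_bounds e ij by blast
  have ends: "i \<in> face E e" "j \<in> face E e"
    unfolding face_def ij using exposed_ends[of i j] b by auto
  have "\<exists>l. l \<in> face E e \<and> i < l \<and> l < j"
    using exposed_adjacent[OF noncrossing_subset[OF nc, of "E - {e}"], of i i j j] ends b
    unfolding face_def ij by auto
  then obtain l where "l \<in> face E e" "i < l" "l < j" by blast
  then have "{i, l, j} \<subseteq> face E e" "card {i, l, j} = 3" using ends by auto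
  moreover have "finite (face E e)" unfolding face_def by simp
  ultimately show ?thesis using card_mono by metis
qed

lemma face_avoids_inner_arc:
  assumes "(x, y) \<in> E" "(x, y) \<noteq> (i, j)" "i \<le> x" "y \<le> j" "l \<in> face E (i, j)"
  shows "l \<le> x \<or> y \<le> l"
proof (rule ccontr)
  assume out: "\<not> (l \<le> x \<or> y \<le> l)"
  have l: "l \<in> exposed i j (E - {(i, j)})" using assms(5) unfolding face_def by simp
  have "(x, y) \<in> E - {(i, j)}" using assms(1,2) by simp
  then show False using exposedD[OF l _ assms(3,4)] out by simp
qed

text \<open>
  Noncrossing arcs are nested or side by side. In each case one of the two arcs has the other face
  entirely on its outer side.
\<close>
lemma faces_separated:
  assumes "(i, j) \<in> E" "(x, y) \<in> E" "(x, y) \<noteq> (i, j)"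
  shows "(\<forall>l\<in>face E (i, j). l \<le> x \<or> y \<le> l) \<or> (\<forall>l\<in>face E (x, y). l \<le> i \<or> j \<le> l)"
proof -
  have "\<not> (i < x \<and> x < j \<and> j < y)" "\<not> (x < i \<and> i < y \<and> y < j)"
    using noncrossingD[OF nc] assms by blast+
  then consider "i \<le> x" "y \<le> j" | "x \<le> i" "j \<le> y" | "y \<le> i" | "j \<le> x" by linarith
  then show ?thesis
  proof cases
    case 1
    then show ?thesis using face_avoids_inner_arc assms by blast
  next
    case 2
    then show ?thesis using face_avoids_inner_arc assms by metis
  next
    case 3
    then show ?thesis using face_subset[of i j] by fastforce
  next
    case 4
    then show ?thesis using face_subset[of i j] by fastforce
  qed
qed

lemma face_region_sides:
  assumes "e \<in> E" "z \<in> region (face E e)" "(x, y) \<in> E \<or> y = Suc x \<and> y < m"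
  shows "z \<notin> chord (x, y)"
proof
  assume zxy: "z \<in> chord (x, y)"
  obtain i j where ij: "e = (i, j)" by (cases e)
  have b: "i < j" "j < m" "x < y" "y < m" using arc_bounds[of i j] arc_bounds[of x y] assms ij by auto
  have xy0: "orient (v x) (v y) z = 0" using orient_segment zxy by simp
  have neg: "orient (v i) (v j) z < 0"
    using region_right[OF assms(2)[unfolded ij] face_subset] b by blast
  have "(x, y) \<noteq> (i, j)" using xy0 neg by auto
  have "\<not> (\<forall>l\<in>face E (i, j). l \<le> x \<or> y \<le> l)"
    using region_left[OF assms(2) face_vertices[OF assms(1)] b(3,4)] xy0 ij by auto
  then have "\<forall>l\<in>face E (x, y). l \<le> i \<or> j \<le> l" "(x, y) \<in> E"
    using faces_separated[of i j x y] assms ij \<open>(x, y) \<noteq> (i, j)\<close> by auto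
  moreover have "x \<in> face E (x, y)" "y \<in> face E (x, y)"
    unfolding face_def using exposed_ends[of x y] b by auto
  ultimately have out: "x \<le> i \<or> j \<le> x" "y \<le> i \<or> j \<le> y" by auto
  have "z \<in> convex hull {v x, v y}" using zxy by (simp add: segment_convex_hull)
  then have "0 \<le> orient (v i) (v j) z"
    by (rule orient_nonneg_hull) (use orient_left_weak[OF b(1,2)] out b in auto)
  then show False using neg by simp
qed

lemma face_regions_disjoint:
  assumes "e \<in> E" "e' \<in> E" "e \<noteq> e'"
  shows "region (face E e) \<inter> region (face E e') = {}"
proof -
  have sep: "region (face E e) \<inter> region (face E e') = {}"
    if e: "e \<in> E" "e' \<in> E" and out: "\<forall>l\<in>face E e. l \<le> fst e' \<or> snd e' \<le> l" for e e'
  proof -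
    obtain x y where xy: "e' = (x, y)" by (cases e')
    have b: "x < y" "y < m" using arc_bounds[of x y] e xy by auto
    have "0 < orient (v x) (v y) z" if "z \<in> region (face E e)" for z
      using region_left[OF that face_vertices[OF e(1)] b] out xy by auto
    moreover have "orient (v x) (v y) z < 0" if "z \<in> region (face E e')" for z
      using region_right[OF that[unfolded xy] face_subset b] .
    ultimately show ?thesis by (metis disjoint_iff less_asym)
  qed
  show ?thesis
    using faces_separated[of "fst e" "snd e" "fst e'" "snd e'"] sep[of e e'] sep[of e' e] assms by auto
qed

text \<open>
  Among the arcs that have \<open>z\<close> on their inner side, take a shortest one. The lower edges of its face are sides
  of the polygon or shorter arcs, so \<open>z\<close> lies above each of them: inside its face. The closing edge ensures that
  there is such an arc.
\<close>
lemma inside_in_face_region: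
  assumes z: "inside_polygon m v z" and off: "\<And>e. e \<in> E \<Longrightarrow> z \<notin> chord e"
  shows "\<exists>e\<in>E. z \<in> region (face E e)"
proof -
  define below where "below e \<longleftrightarrow> e \<in> E \<and> orient (v (fst e)) (v (snd e)) z < 0" for e
  have "below (0, m - 1)" using z top unfolding below_def inside_polygon_def by simp
  then obtain e where e: "below e" and least: "\<And>e'. below e' \<Longrightarrow> snd e - fst e \<le> snd e' - fst e'"
    using ex_has_least_nat[of below "(0, m - 1)" "\<lambda>e. snd e - fst e"] by blast
  obtain i j where ij: "e = (i, j)" by (cases e)
  have eE: "(i, j) \<in> E" "orient (v i) (v j) z < 0" using e ij unfolding below_def by auto
  have b: "i + 2 \<le> j" "j < m" using arc_bounds eE by auto
  let ?X = "exposed i j (E - {(i, j)})"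
  have X: "face E e = ?X" unfolding face_def ij by simp
  define xs where "xs = sorted_list_of_set ?X"
  have srt: "sorted_wrt (<) xs" and set: "set xs = ?X" unfolding xs_def by auto
  have "set xs \<subseteq> {..<m}" using set face_vertices[of e] X eE(1) ij by simp
  have len: "length xs \<ge> 3" using card_face[of e] X eE(1) ij unfolding xs_def by simp
  have "xs ! 0 = i"
    using sorted_list_of_exposed[of i j "E - {(i, j)}"] b unfolding xs_def by (metis add_2_eq_Suc' Suc_le_lessD Suc_lessD nth_Cons_0)
  have "xs ! (length xs - 1) = j"
    using last_sorted_list_of_exposed[of i j "E - {(i, j)}"] b unfolding xs_def[symmetric]
    by (simp add: last_conv_nth)
  have "inside_polygon (length xs) (v \<circ> nth xs) z"
    unfolding inside_polygon_def
  proof (intro conjI allI impI)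
    fix t assume t: "Suc t < length xs"
    define x y where "x = xs ! t" and "y = xs ! Suc t"
    have xy: "x < y" using srt t sorted_wrt_nth_less[OF srt, of t "Suc t"] unfolding x_def y_def by simp
    have "x \<in> set xs" "y \<in> set xs" using t unfolding x_def y_def by auto
    then have "x \<in> ?X" "y \<in> ?X" using set by auto
    have "False" if "l \<in> ?X" "x < l" "l < y" for l
    proof -
      obtain s where s: "s < length xs" "xs ! s = l" using \<open>l \<in> ?X\<close> set by (metis in_set_conv_nth)
      have "t < s" using sorted_wrt_nth_less[OF srt, of s t] s t that(2) unfolding x_def
        by (metis Suc_lessD less_asym less_irrefl linorder_neqE_nat)
      moreover have "s < Suc t" using sorted_wrt_nth_less[OF srt, of "Suc t" s] s t that(3) unfolding y_def
        by (metis less_asym less_irrefl linorder_neqE_nat)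
      ultimately show False by simp
    qed
    then have adj: "y = Suc x \<or> (x, y) \<in> E - {(i, j)}"
      using exposed_adjacent[OF noncrossing_subset[OF nc] \<open>x \<in> ?X\<close> \<open>y \<in> ?X\<close> xy] by blast
    have bd: "i \<le> x" "y \<le> j" using \<open>x \<in> ?X\<close> \<open>y \<in> ?X\<close> by (auto simp: exposed_iff)
    have "0 < orient (v x) (v y) z"
    proof (cases "y = Suc x")
      case True
      then show ?thesis using z bd b unfolding inside_polygon_def by auto
    next
      case False
      then have arc: "(x, y) \<in> E" "(x, y) \<noteq> (i, j)" using adj by auto
      have "y - x < j - i" using bd arc xy by auto
      then have "\<not> below (x, y)" using least[of "(x, y)"] ij by auto
      then have "0 \<le> orient (v x) (v y) z" using arc unfolding below_def by auto
      moreover have "orient (v x) (v y) z \<noteq> 0"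
      proof
        assume 0: "orient (v x) (v y) z = 0"
        have b': "x + 2 \<le> y" "y < m" using arc_bounds arc by auto
        have "z \<in> convex hull (v ` {x..y})"
          using inside_right_of_chord_hull[OF z b'] 0 by simp
        then have "z \<in> chord (x, y)"
          by (rule hull_on_chord_segment) (use b' xy 0 in auto)
        then show False using off arc by blast
      qed
      ultimately show ?thesis by simp
    qed
    then show "0 < orient ((v \<circ> nth xs) t) ((v \<circ> nth xs) (Suc t)) z"
      unfolding x_def y_def by simp
  next
    show "orient ((v \<circ> nth xs) 0) ((v \<circ> nth xs) (length xs - 1)) z < 0"
      using eE(2) \<open>xs ! 0 = i\<close> \<open>xs ! (length xs - 1) = j\<close> by simp
  qed
  then have "z \<in> interior (convex hull ((v \<circ> nth xs) ` {..<length xs}))"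
    using inside_polygon_interior[OF strict_sorted_subpolygon[OF srt \<open>set xs \<subseteq> {..<m}\<close>] len] by blast
  then have "z \<in> region (face E e)" unfolding image_nth set X .
  then show ?thesis using eE ij by blast
qed

text \<open>
  The face regions and the exterior of the polygon are disjoint nonempty connected open sets that
  fill the complement of the drawing, hence they are its components.
\<close>
theorem bounded_regions_eq_faces:
  "bounded_regions m v (chord ` (E - {(0, m - 1)})) = (\<lambda>e. region (face E e)) ` E"
proof -
  let ?H = "convex hull (v ` {..<m})"
  let ?X = "\<Union> (sides m v) \<union> \<Union> (chord ` (E - {(0, m - 1)}))"
  let ?R = "(\<lambda>e. region (face E e)) ` E"
  have top_side: "chord (0, m - 1) \<in> sides m v" using top_in_sides m by simp
  have X: "z \<in> ?X \<longleftrightarrow> (\<exists>x y. ((x, y) \<in> E \<or> y = Suc x \<and> y < m) \<and> z \<in> chord (x, y))" for z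
  proof
    assume "z \<in> ?X"
    then consider i where "i < m" "z \<in> closed_segment (v i) (v (Suc i mod m))"
      | e where "e \<in> E" "z \<in> chord e" unfolding sides_def by blast
    then show "\<exists>x y. ((x, y) \<in> E \<or> y = Suc x \<and> y < m) \<and> z \<in> chord (x, y)"
    proof cases
      case 1
      show ?thesis
      proof (cases "Suc i < m")
        case True
        then show ?thesis using 1 by (intro exI[of _ i] exI[of _ "Suc i"]) auto
      next
        case False
        then have "Suc i = m" using 1 by simp
        then have "z \<in> chord (0, m - 1)" using 1 by (auto simp: closed_segment_commute)
        then show ?thesis using top by blast
      qed
    next
      case 2
      then show ?thesis by (intro exI[of _ "fst e"] exI[of _ "snd e"]) auto
    qed
  next
    assume "\<exists>x y. ((x, y) \<in> E \<or> y = Suc x \<and> y < m) \<and> z \<in> chord (x, y)"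
    then obtain x y where xy: "(x, y) \<in> E \<or> y = Suc x \<and> y < m" "z \<in> chord (x, y)" by blast
    show "z \<in> ?X"
    proof (cases "(x, y) \<in> E \<and> (x, y) \<noteq> (0, m - 1)")
      case True
      then show ?thesis using xy(2) by blast
    next
      case False
      then have "chord (x, y) \<in> sides m v" using xy(1) top_side side_in_sides[of x] by auto
      then show ?thesis using xy(2) by blast
    qed
  qed
  have sub: "region (face E e) \<subseteq> ?H" if "e \<in> E" for e
  proof -
    have "convex hull (v ` face E e) \<subseteq> ?H" using face_vertices[OF that] by (intro hull_mono image_mono)
    then show ?thesis using interior_subset by (rule order_trans[rotated])
  qed
  have "bounded ?H" by (simp add: bounded_convex_hull finite_imp_bounded)
  then have unb: "\<not> bounded (- ?H)" using cobounded_imp_unbounded[of "- ?H"] by simp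
  \<comment> \<open>The exterior is the only unbounded component.\<close>
  have comps: "components (- ?X) = insert (- ?H) ?R"
  proof (rule components_open_unique)
    have inner: "disjnt Y Y'" if "Y \<in> ?R" "Y' \<in> ?R" "Y \<noteq> Y'" for Y Y'
    proof -
      obtain e e' where "e \<in> E" "e' \<in> E" "Y = region (face E e)" "Y' = region (face E e')"
        using \<open>Y \<in> ?R\<close> \<open>Y' \<in> ?R\<close> by blast
      then show ?thesis using face_regions_disjoint[of e e'] \<open>Y \<noteq> Y'\<close> unfolding disjnt_def by blast
    qed
    have outer: "disjnt (- ?H) Y" "disjnt Y (- ?H)" if "Y \<in> ?R" for Y
      using that sub unfolding disjnt_def by blast+
    show "pairwise disjnt (insert (- ?H) ?R)"
    proof (rule pairwiseI)
      fix Y Y' assume Y: "Y \<in> insert (- ?H) ?R" "Y' \<in> insert (- ?H) ?R" "Y \<noteq> Y'"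
      then consider "Y \<in> ?R" "Y' \<in> ?R" | "Y = - ?H" "Y' \<in> ?R" | "Y \<in> ?R" "Y' = - ?H" by blast
      then show "disjnt Y Y'" using inner outer Y(3) by cases blast+
    qed
    show "\<Union> (insert (- ?H) ?R) = - ?X"
    proof (rule set_eqI)
      fix z
      show "z \<in> \<Union> (insert (- ?H) ?R) \<longleftrightarrow> z \<in> - ?X"
      proof
        assume "z \<in> \<Union> (insert (- ?H) ?R)"
        then consider "z \<notin> ?H" | e where "e \<in> E" "z \<in> region (face E e)" by auto
        then have "z \<notin> chord (x, y)" if "(x, y) \<in> E \<or> y = Suc x \<and> y < m" for x y
        proof cases
          case 1
          have "x < m" "y < m" using that arc_bounds[of x y] by auto
          then show ?thesis using chord_subset_hull[of x "{..<m}" y] 1 by auto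
        next
          case 2
          then show ?thesis using face_region_sides that by blast
        qed
        then have "z \<notin> ?X" unfolding X by blast
        then show "z \<in> - ?X" by (simp only: Compl_iff not_False_eq_True)
      next
        assume "z \<in> - ?X"
        then have z: "z \<notin> ?X" by (rule ComplD)
        show "z \<in> \<Union> (insert (- ?H) ?R)"
        proof (cases "z \<in> ?H")
          case True
          have "inside_polygon m v z" using hull_minus_sides_inside[OF m True] z by blast
          moreover have "z \<notin> chord e" if "e \<in> E" for e
            using z that unfolding X by (cases e) blast
          ultimately obtain e where "e \<in> E" "z \<in> region (face E e)"
            using inside_in_face_region by blast
          then show ?thesis by blast
        qed simp
      qed
    qed
    show "open Y \<and> connected Y \<and> Y \<noteq> {}" if Y: "Y \<in> insert (- ?H) ?R" for Y
    proof -
      consider "Y = - ?H" | e where "e \<in> E" "Y = region (face E e)" using Y by blast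
      then show ?thesis
      proof cases
        case 1
        have "closed ?H" by (simp add: compact_imp_closed finite_imp_compact_convex_hull)
        moreover have "connected (- ?H)"
          by (rule connected_complement_bounded_convex[OF \<open>bounded ?H\<close>]) auto
        moreover have "- ?H \<noteq> {}" using unb by (intro notI) simp
        ultimately show ?thesis using 1 by (simp add: open_closed)
      next
        case 2
        then have "Y \<noteq> {}" using region_nonempty[OF face_vertices[OF 2(1)] card_face[OF 2(1)]] by simp
        then show ?thesis using 2 by (simp add: convex_connected convex_interior)
      qed
    qed
  qed
  have bnd: "bounded Y" if Y: "Y \<in> ?R" for Y
  proof -
    obtain e where "e \<in> E" "Y = region (face E e)" using Y by blast
    then have "Y \<subseteq> ?H" using sub by simp
    then show ?thesis by (rule bounded_subset[OF \<open>bounded ?H\<close>])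
  qed
  show ?thesis unfolding bounded_regions_def comps
  proof (rule set_eqI)
    fix Y
    show "Y \<in> {Y \<in> insert (- ?H) ?R. bounded Y} \<longleftrightarrow> Y \<in> ?R"
      using bnd[of Y] unb by (simp only: mem_Collect_eq insert_iff) metis
  qed
qed

end

end

section \<open>Proper partitions as balanced arc systems\<close>

context
  fixes m :: nat and v :: "nat \<Rightarrow> complex"
  assumes polygon: "convex_polygon m v" and m: "m \<ge> 3"
begin

lemma chord_eq_iff:
  assumes "i < j" "j < m" "p < q" "q < m"
  shows "chord v (i, j) = chord v (p, q) \<longleftrightarrow> (i, j) = (p, q)"
  using assms vertex_eq_iff[OF polygon] by (auto simp: doubleton_eq_iff)

lemma chord_in_chords_iff:
  assumes "i < j" "j < m"
  shows "chord v (i, j) \<in> chords m v \<longleftrightarrow> i + 2 \<le> j \<and> (i, j) \<noteq> (0, m - 1)"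
proof -
  have side: "chord v (i, j) = closed_segment (v l) (v (Suc l mod m)) \<longleftrightarrow>
      (if Suc l < m then i = l \<and> j = Suc l else i = 0 \<and> j = m - 1)" if "l < m" for l
  proof (cases "Suc l < m")
    case True
    then show ?thesis using chord_eq_iff[OF assms, of l "Suc l"] by auto
  next
    case False
    then have "Suc l = m" using that by simp
    then have "closed_segment (v l) (v (Suc l mod m)) = chord v (0, m - 1)"
      by (auto simp: closed_segment_commute)
    then show ?thesis using chord_eq_iff[OF assms, of 0 "m - 1"] False m by auto
  qed
  have "chord v (i, j) \<in> sides m v \<longleftrightarrow> (\<exists>l<m. chord v (i, j) = closed_segment (v l) (v (Suc l mod m)))"
    unfolding sides_def by blast
  also have "\<dots> \<longleftrightarrow> (\<exists>l<m. if Suc l < m then i = l \<and> j = Suc l else i = 0 \<and> j = m - 1)"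
    using side by blast
  also have "\<dots> \<longleftrightarrow> j = Suc i \<or> (i, j) = (0, m - 1)"
  proof
    assume "j = Suc i \<or> (i, j) = (0, m - 1)"
    then show "\<exists>l<m. if Suc l < m then i = l \<and> j = Suc l else i = 0 \<and> j = m - 1"
    proof
      assume "j = Suc i"
      then show ?thesis using assms by (intro exI[of _ i]) auto
    next
      assume "(i, j) = (0, m - 1)"
      then show ?thesis using m by (intro exI[of _ "m - 1"]) auto
    qed
  qed (auto split: if_splits)
  finally have "chord v (i, j) \<in> sides m v \<longleftrightarrow> j = Suc i \<or> (i, j) = (0, m - 1)" .
  moreover have "\<exists>p q. chord v (i, j) = closed_segment (v p) (v q) \<and> p < m \<and> q < m \<and> p \<noteq> q"
    using assms by (intro exI[of _ i] exI[of _ j]) auto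
  ultimately show ?thesis unfolding chords_def using assms by auto
qed

lemma chords_form:
  assumes "c \<in> chords m v"
  obtains i j where "i < j" "j < m" "c = chord v (i, j)"
proof -
  obtain p q where pq: "c = closed_segment (v p) (v q)" "p < m" "q < m" "p \<noteq> q"
    using assms unfolding chords_def by blast
  then have "p < q \<and> c = chord v (p, q) \<or> q < p \<and> c = chord v (q, p)"
    by (auto simp: closed_segment_commute)
  then show ?thesis using that pq by blast
qed

text \<open>
  A region determines its vertex set, so the conditions on the regions of the drawing are conditions on the
  faces of the arc system.
\<close>
lemma proper_k_partition_iff_balanced:
  assumes k: "k \<ge> 3" and E: "E \<subseteq> arcs 0 (m - 1)" and top: "(0, m - 1) \<in> E"
  shows "proper_k_partition k m v (chord v ` (E - {(0, m - 1)})) \<longleftrightarrow> noncrossing E \<and> balanced k E"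
proof -
  let ?D = "chord v ` (E - {(0, m - 1)})"
  have bd: "i + 2 \<le> j" "j < m" if "(i, j) \<in> E" for i j using E m that by (auto simp: arcs_def)
  have "c \<in> chords m v" if c: "c \<in> ?D" for c
  proof -
    obtain e where e: "e \<in> E" "e \<noteq> (0, m - 1)" "c = chord v e" using c by blast
    obtain i j where ij: "e = (i, j)" by (cases e)
    have "i + 2 \<le> j" "j < m" using bd e(1) ij by auto
    then have "chord v (i, j) \<in> chords m v" using chord_in_chords_iff[of i j] e(2) ij by simp
    then show ?thesis unfolding e(3) ij .
  qed
  then have chords: "?D \<subseteq> chords m v" by blast
  have disj: "(\<forall>c\<in>?D. \<forall>d\<in>?D. c \<noteq> d \<longrightarrow> c \<inter> d \<inter> region v {..<m} = {}) \<longleftrightarrow> noncrossing E"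
  proof
    assume disjoint: "\<forall>c\<in>?D. \<forall>d\<in>?D. c \<noteq> d \<longrightarrow> c \<inter> d \<inter> region v {..<m} = {}"
    have False if *: "(i, j) \<in> E" "(p, q) \<in> E" "i < p" "p < j" "j < q" for i j p q
    proof -
      have "(i, j) \<noteq> (0, m - 1)" "(p, q) \<noteq> (0, m - 1)" using * bd(2)[of p q] by auto
      then have "chord v (i, j) \<in> ?D" "chord v (p, q) \<in> ?D" using * by blast+
      moreover have "chord v (i, j) \<noteq> chord v (p, q)"
        using chord_eq_iff[of i j p q] * bd[of i j] bd[of p q] by simp
      ultimately have "chord v (i, j) \<inter> chord v (p, q) \<inter> region v {..<m} = {}" using disjoint by blast
      then show False using crossing_chords_meet[OF polygon *(3-5) bd(2)[OF *(2)]] by blast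
    qed
    then show "noncrossing E" unfolding noncrossing_def by blast
  next
    assume nc: "noncrossing E"
    show "\<forall>c\<in>?D. \<forall>d\<in>?D. c \<noteq> d \<longrightarrow> c \<inter> d \<inter> region v {..<m} = {}"
    proof (intro ballI impI)
      fix c d assume "c \<in> ?D" "d \<in> ?D" "c \<noteq> d"
      then obtain e f where ef: "e \<in> E" "c = chord v e" "f \<in> E" "d = chord v f" by blast
      obtain i j where ij1: "e = (i, j)" by (cases e)
      obtain p q where ij2: "f = (p, q)" by (cases f)
      note ij = ij1 ij2
      have "(i, j) \<noteq> (p, q)" using \<open>c \<noteq> d\<close> ef ij by auto
      have "\<not> (i < p \<and> p < j \<and> j < q)" "\<not> (p < i \<and> i < q \<and> q < j)"
        using noncrossingD[OF nc] ef ij by blast+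
      then show "c \<inter> d \<inter> region v {..<m} = {}"
        using noncrossing_chords_disjoint[OF polygon _ _ _ _ \<open>(i, j) \<noteq> (p, q)\<close>]
          bd[of i j] bd[of p q] ef ij by simp
    qed
  qed
  have main: "proper_k_partition k m v ?D \<longleftrightarrow> (\<forall>e\<in>E. card (face E e) = k \<and> colour k ` face E e = {1..k})"
    if nc: "noncrossing E"
  proof -
    note facts = polygon E m top nc
    have regions: "bounded_regions m v ?D = (\<lambda>e. region v (face E e)) ` E"
      by (rule bounded_regions_eq_faces[OF facts])
    have eq: "region v (face E e) = region v S \<longleftrightarrow> face E e = S"
      if "e \<in> E" "S \<subseteq> {..<m}" "card S = k" for e S
      by (rule region_eq_iff[OF polygon]) 
        (use that k face_vertices[OF facts that(1)] card_face[OF facts that(1)] in auto)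
    have size: "(\<forall>R\<in>bounded_regions m v ?D. \<exists>S\<subseteq>{..<m}. card S = k \<and> R = region v S) \<longleftrightarrow>
        (\<forall>e\<in>E. card (face E e) = k)"
    proof
      assume *: "\<forall>R\<in>bounded_regions m v ?D. \<exists>S\<subseteq>{..<m}. card S = k \<and> R = region v S"
      show "\<forall>e\<in>E. card (face E e) = k"
      proof
        fix e assume e: "e \<in> E"
        then have "region v (face E e) \<in> bounded_regions m v ?D" unfolding regions by blast
        with * have "\<exists>S\<subseteq>{..<m}. card S = k \<and> region v (face E e) = region v S" by (rule bspec)
        then obtain S where S: "S \<subseteq> {..<m}" "card S = k" "region v (face E e) = region v S" by blast
        then have "face E e = S" using eq[OF e S(1,2)] by blast
        then show "card (face E e) = k" using S(2) by simp
      qed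
    next
      assume card: "\<forall>e\<in>E. card (face E e) = k"
      show "\<forall>R\<in>bounded_regions m v ?D. \<exists>S\<subseteq>{..<m}. card S = k \<and> R = region v S"
      proof
        fix R assume "R \<in> bounded_regions m v ?D"
        then obtain e where e: "e \<in> E" "R = region v (face E e)" unfolding regions by blast
        then show "\<exists>S\<subseteq>{..<m}. card S = k \<and> R = region v S"
          using card face_vertices[OF facts e(1)] by (intro exI[of _ "face E e"]) simp
      qed
    qed
    have kp: "k_partition k m v ?D \<longleftrightarrow> (\<forall>e\<in>E. card (face E e) = k)"
      by (simp only: k_partition_def chords disj nc size simp_thms)
    have col: "(\<forall>S\<subseteq>{..<m}. card S = k \<and> region v S \<in> bounded_regions m v ?D \<longrightarrow> colour k ` S = {1..k}) \<longleftrightarrow>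
        (\<forall>e\<in>E. colour k ` face E e = {1..k})" if card: "\<forall>e\<in>E. card (face E e) = k"
    proof
      assume *: "\<forall>S\<subseteq>{..<m}. card S = k \<and> region v S \<in> bounded_regions m v ?D \<longrightarrow> colour k ` S = {1..k}"
      show "\<forall>e\<in>E. colour k ` face E e = {1..k}"
      proof
        fix e assume e: "e \<in> E"
        then have "region v (face E e) \<in> bounded_regions m v ?D" unfolding regions by blast
        then show "colour k ` face E e = {1..k}" using *[rule_format, OF face_vertices[OF facts e]] card e by simp
      qed
    next
      assume *: "\<forall>e\<in>E. colour k ` face E e = {1..k}"
      show "\<forall>S\<subseteq>{..<m}. card S = k \<and> region v S \<in> bounded_regions m v ?D \<longrightarrow> colour k ` S = {1..k}"
      proof (intro allI impI)
        fix S assume S: "S \<subseteq> {..<m}" "card S = k \<and> region v S \<in> bounded_regions m v ?D"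
        then obtain e where e: "e \<in> E" "region v S = region v (face E e)" unfolding regions by blast
        then have "face E e = S" using eq[OF e(1) S(1) conjunct1[OF S(2)]] e(2) by metis
        then show "colour k ` S = {1..k}" using * e(1) by blast
      qed
    qed
    show ?thesis
    proof (cases "\<forall>e\<in>E. card (face E e) = k")
      case True
      then have colours: "(\<forall>e\<in>E. card (face E e) = k \<and> colour k ` face E e = {1..k}) \<longleftrightarrow>
          (\<forall>e\<in>E. colour k ` face E e = {1..k})" by (intro ball_cong) simp_all
      have "k_partition k m v ?D" using kp True by (rule iffD2)
      then have "proper_k_partition k m v ?D \<longleftrightarrow> (\<forall>e\<in>E. colour k ` face E e = {1..k})"
        by (simp only: proper_k_partition_def col[OF True] simp_thms)
      then show ?thesis unfolding colours .
    next
      case False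
      then show ?thesis unfolding proper_k_partition_def kp by blast
    qed
  qed
  show ?thesis
  proof (cases "noncrossing E")
    case True
    then show ?thesis using main rainbow_faces_iff_balanced[OF k E] by simp
  next
    case False
    then have "\<not> k_partition k m v ?D" by (simp only: k_partition_def disj simp_thms not_False_eq_True)
    then show ?thesis using False unfolding proper_k_partition_def by blast
  qed
qed

lemma bij_betw_proper_k_partitions:
  assumes k: "k \<ge> 3"
  shows "bij_betw (\<lambda>E. chord v ` (E - {(0, m - 1)}))
    {E. E \<subseteq> arcs 0 (m - 1) \<and> (0, m - 1) \<in> E \<and> noncrossing E \<and> balanced k E}
    {D. proper_k_partition k m v D}"
    (is "bij_betw ?f ?Y ?X")
proof (rule bij_betw_imageI)
  have bd: "i < j" "j < m" if "(i, j) \<in> arcs 0 (m - 1)" for i j using m that by (auto simp: arcs_def)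
  have inj: "inj_on (chord v) (arcs 0 (m - 1))"
  proof (rule inj_onI)
    fix e f assume ef: "e \<in> arcs 0 (m - 1)" "f \<in> arcs 0 (m - 1)" "chord v e = chord v f"
    obtain i j where e: "e = (i, j)" by (cases e)
    obtain p q where f: "f = (p, q)" by (cases f)
    have "i < j" "j < m" "p < q" "q < m" using bd ef(1,2) e f by auto
    then show "e = f" using chord_eq_iff[of i j p q] ef(3) unfolding e f by blast
  qed
  show "inj_on ?f ?Y"
  proof (rule inj_onI)
    fix E F assume EF: "E \<in> ?Y" "F \<in> ?Y" "?f E = ?f F"
    then have "E - {(0, m - 1)} \<subseteq> arcs 0 (m - 1)" "F - {(0, m - 1)} \<subseteq> arcs 0 (m - 1)" by auto
    then have "E - {(0, m - 1)} = F - {(0, m - 1)}" using inj_on_image_eq_iff[OF inj] EF(3) by simp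
    then show "E = F" using EF(1,2) by blast
  qed
  show "?f ` ?Y = ?X"
  proof (intro equalityI subsetI)
    fix D assume "D \<in> ?f ` ?Y"
    then show "D \<in> ?X" using proper_k_partition_iff_balanced[OF k] by auto
  next
    fix D assume D: "D \<in> ?X"
    then have "D \<subseteq> chords m v" by (simp add: proper_k_partition_def k_partition_def)
    define E where "E = insert (0, m - 1) {e \<in> arcs 0 (m - 1). e \<noteq> (0, m - 1) \<and> chord v e \<in> D}"
    have E: "E \<subseteq> arcs 0 (m - 1)" "(0, m - 1) \<in> E" using m unfolding E_def by (auto simp: arcs_def)
    have "?f E = D"
    proof (intro equalityI subsetI)
      fix c assume c: "c \<in> D"
      then have "c \<in> chords m v" using \<open>D \<subseteq> chords m v\<close> by blast
      then obtain i j where ij: "i < j" "j < m" "c = chord v (i, j)" using chords_form by blast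
      then have "i + 2 \<le> j" "(i, j) \<noteq> (0, m - 1)"
        using \<open>c \<in> chords m v\<close> chord_in_chords_iff[OF ij(1,2)] by auto
      then have "(i, j) \<in> E - {(0, m - 1)}" using ij c unfolding E_def by (auto simp: arcs_def)
      then show "c \<in> ?f E" using ij(3) by blast
    qed (auto simp: E_def)
    then show "D \<in> ?f ` ?Y" using D E proper_k_partition_iff_balanced[OF k E] by auto
  qed
qed

end

text \<open>
  Since the closing edge covers everything, an arc system containing it is a forest with a single tree; its root
  has step \<open>1\<close> or \<open>-1\<close>.
\<close>
lemma rooted_forests:
  assumes "m \<ge> 3" "k \<ge> 3"
  shows "{E. E \<subseteq> arcs 0 (m - 1) \<and> (0, m - 1) \<in> E \<and> noncrossing E \<and> balanced k E} =
    forests k 0 (m - 1) [1] \<union> forests k 0 (m - 1) [k - 1]"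
proof -
  let ?b = "m - 1"
  \<comment> \<open>The closing edge leaves only its endpoints exposed.\<close>
  have root: "sorted_list_of_set (exposed 0 ?b E) = [0, ?b]" if "(0, ?b) \<in> E" for E
  proof -
    have "l = 0 \<or> l = ?b" if "l \<in> exposed 0 ?b E" for l
      using exposedD[OF that \<open>(0, ?b) \<in> E\<close>] exposed_subset[of 0 ?b E] that by fastforce
    then have "exposed 0 ?b E = {0, ?b}" using exposed_ends[of 0 ?b E] by auto
    then show ?thesis using assms(1) by (intro sorted_list_of_set_eqI) auto
  qed
  have "(0, ?b) \<in> E" if "E \<in> forests k 0 ?b [c]" for E c
  proof -
    obtain q rest where L: "sorted_list_of_set (exposed 0 ?b E) = 0 # q # rest"
      using sorted_list_of_exposed[of 0 ?b E] assms(1) by auto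
    have st: "steps k (0 # q # rest) = [c]" using that L by (simp add: forests_def)
    then have "rest = []" by (cases rest) auto
    then have "set (sorted_list_of_set (exposed 0 ?b E)) = {0, q}" using L by simp
    then have X: "exposed 0 ?b E = {0, q}" by simp
    then have "q = ?b" using exposed_ends[of 0 ?b E] assms(1) by auto
    moreover have "q = Suc 0 \<or> (0, q) \<in> E"
      by (rule exposed_adjacent[of E _ 0 ?b])
        (use that X \<open>q = ?b\<close> assms(1) in \<open>auto simp: forests_def\<close>)
    ultimately show ?thesis using assms(1) by auto
  qed
  moreover have "E \<in> forests k 0 ?b [1] \<union> forests k 0 ?b [k - 1]"
    if "E \<subseteq> arcs 0 ?b" "(0, ?b) \<in> E" "noncrossing E" "balanced k E" for E
    using balanced_residue[OF that(4,2)] that root[OF that(2)] assms by (auto simp: forests_def)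
  ultimately show ?thesis by (auto simp: forests_def)
qed

lemma num_proper_k_partitions_eq:
  assumes "convex_polygon m v" "m \<ge> 3" "k \<ge> 3"
  shows "num_proper_k_partitions k m v = card (forests k 0 (m - 1) [1]) + card (forests k 0 (m - 1) [k - 1])"
proof -
  have "num_proper_k_partitions k m v = card (forests k 0 (m - 1) [1] \<union> forests k 0 (m - 1) [k - 1])"
    unfolding num_proper_k_partitions_def
    using bij_betw_same_card[OF bij_betw_proper_k_partitions[OF assms]] rooted_forests[OF assms(2,3)] by simp
  also have "\<dots> = card (forests k 0 (m - 1) [1]) + card (forests k 0 (m - 1) [k - 1])"
    by (rule card_Un_disjoint) (use assms(3) in \<open>auto simp: finite_forests, auto simp: forests_def\<close>)
  finally show ?thesis .
qed

text \<open>
  A segment does not separate the plane, so the degenerate polygon has no bounded region.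
\<close>
lemma num_proper_k_partitions_edge: "num_proper_k_partitions k 2 v = 1"
proof -
  have two: "i < 2 \<longleftrightarrow> i = 0 \<or> i = 1" for i :: nat by auto
  have "sides 2 v = (\<lambda>i. closed_segment (v i) (v (Suc i mod 2))) ` {0, 1}"
    unfolding sides_def two by blast
  also have "\<dots> = {closed_segment (v 0) (v 1), closed_segment (v 1) (v 0)}" by simp
  also have "\<dots> = {closed_segment (v 0) (v 1)}" by (metis closed_segment_commute insert_absorb2)
  finally have sides: "sides 2 v = {closed_segment (v 0) (v 1)}" .
  have chords: "chords 2 v = {}"
  proof -
    have "c = closed_segment (v 0) (v 1)" if c: "c = closed_segment (v p) (v q)" "p < 2" "q < 2" "p \<noteq> q" for c p q
    proof -
      have "p = 0 \<and> q = 1 \<or> p = 1 \<and> q = 0" using c(2-4) by linarith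
      then show ?thesis using c(1) by (metis closed_segment_commute)
    qed
    then show ?thesis unfolding chords_def sides by blast
  qed
  have "bounded_regions 2 v {} = {}"
  proof -
    let ?s = "closed_segment (v 0) (v 1)"
    have "bounded ?s" by (simp add: compact_imp_bounded)
    then have "connected (- ?s)" by (rule connected_complement_bounded_convex) auto
    moreover have "\<not> bounded (- ?s)" using \<open>bounded ?s\<close> cobounded_imp_unbounded[of "- ?s"] by simp
    moreover have "- ?s \<noteq> {}" using \<open>\<not> bounded (- ?s)\<close> by (intro notI) simp
    ultimately have "components (- ?s) = {- ?s}" by (simp add: components_eq_sing_iff)
    then show ?thesis using \<open>\<not> bounded (- ?s)\<close> unfolding bounded_regions_def sides by simp
  qed
  then have "proper_k_partition k 2 v D \<longleftrightarrow> D = {}" for D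
    by (auto simp: proper_k_partition_def k_partition_def chords)
  then have "{D. proper_k_partition k 2 v D} = {{}}" by simp
  then show ?thesis unfolding num_proper_k_partitions_def by simp
qed

theorem theorem3p1:
  fixes k N :: nat and v :: "nat \<Rightarrow> complex"
  assumes "k \<ge> 4" and "convex_polygon (N + 2) v"
  defines "c \<equiv> num_proper_k_partitions k (N + 2) v"
  shows "(N = 0 \<longrightarrow> c = 1) \<and>
    (\<forall>n::nat. n \<ge> 1 \<and> N = (k - 2) * k * n \<longrightarrow>
        real c = 1 / real n * real (((k - 1)^2 * n) choose (n - 1))) \<and>
    (\<forall>n::nat. N = (k - 2) * (k * n + 1) \<longrightarrow>
        real c = (if n = 0 then 1
                  else real (k - 1) / real n * real (((k - 1)^2 * n + (k - 2)) choose (n - 1)))) \<and>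
    (N \<ge> 1 \<and> (\<nexists>n::nat. n \<ge> 1 \<and> N = (k - 2) * k * n) \<and> (\<nexists>n::nat. N = (k - 2) * (k * n + 1)) \<longrightarrow>
        c = 0)"
proof (cases "N = 0")
  case True
  have "c = 1" unfolding c_def True using num_proper_k_partitions_edge[of k v] by (simp add: numeral_2_eq_2)
  moreover have "(k - 2) * k * n \<noteq> 0" if "n \<ge> 1" for n using that assms(1) by simp
  moreover have "(k - 2) * (k * n + 1) \<noteq> 0" for n using assms(1) by simp
  ultimately show ?thesis using True by auto
next
  case False
  define K where "K = (k - 2) * k"
  define X where "X = card (forests k 0 (N + 1) [1])"
  define Y where "Y = card (forests k 0 (N + 1) [k - 1])"
  have c: "c = X + Y"
    unfolding c_def X_def Y_def using num_proper_k_partitions_eq[OF assms(2), of k] False assms(1) by simp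
  have p: "(k - 1)^2 \<ge> 1" using assms(1) by simp
  have X: "X = raney ((k - 1)^2) n 1" if "N = K * n" for n
    using card_forests[of k 0 "N + 1" "[1]"] that assms(1) unfolding X_def K_def by (simp add: mult.commute)
  have X0: "X = 0" if "\<nexists>n. N = K * n"
    using card_forests[of k 0 "N + 1" "[1]"] that assms(1) unfolding X_def K_def by (simp add: mult.commute)
  have split: "N + 1 = k - 1 + K * n \<longleftrightarrow> N = (k - 2) * (k * n + 1)" for n
  proof -
    have "(k - 2) * (k * n + 1) = K * n + (k - 2)"
      unfolding K_def by (simp add: distrib_left mult.assoc)
    then show ?thesis using assms(1) by linarith
  qed
  have Y: "Y = raney ((k - 1)^2) n (k - 1)" if "N = (k - 2) * (k * n + 1)" for n
    using card_forests[of k 0 "N + 1" "[k - 1]"] split[of n] that assms(1)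
    unfolding Y_def K_def by (simp add: mult.commute)
  have Y0: "Y = 0" if "\<nexists>n. N = (k - 2) * (k * n + 1)"
    using card_forests[of k 0 "N + 1" "[k - 1]"] split that assms(1)
    unfolding Y_def K_def by (simp add: mult.commute)
  \<comment> \<open>The number of regions is \<open>N / (k - 2)\<close>; it is \<open>0\<close> modulo \<open>k\<close> for roots of step \<open>1\<close> and \<open>1\<close> for the others.\<close>
  have exclusive: "K * n \<noteq> (k - 2) * (k * n' + 1)" for n n'
  proof
    assume "K * n = (k - 2) * (k * n' + 1)"
    then have "(k - 2) * (k * n) = (k - 2) * (k * n' + 1)" unfolding K_def by (simp add: mult.assoc)
    then have "k * n = k * n' + 1" using assms(1) by (subst (asm) mult_cancel1) simp
    then have "k dvd k * n' + 1" by (metis dvd_triv_left)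
    then have "k dvd 1" by (metis dvd_add_right_iff dvd_triv_left)
    then show False using assms(1) by simp
  qed
  have first: "real c = 1 / real n * real (((k - 1)^2 * n) choose (n - 1))"
    if n: "n \<ge> 1" "N = (k - 2) * k * n" for n
  proof -
    have "Y = 0" using Y0 n(2) exclusive unfolding K_def by metis
    then have "c = raney ((k - 1)^2) n 1" using c X[of n] n(2) unfolding K_def by simp
    then show ?thesis using raney_closed_form[OF p n(1), of 1] n(1) by (simp add: field_simps)
  qed
  have second: "real c = (if n = 0 then 1
      else real (k - 1) / real n * real (((k - 1)^2 * n + (k - 2)) choose (n - 1)))"
    if n: "N = (k - 2) * (k * n + 1)" for n
  proof -
    have "X = 0" using X0 n exclusive by metis
    then have cY: "c = raney ((k - 1)^2) n (k - 1)" using c Y[OF n] by simp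
    have "(k - 1)^2 * n + (k - 1) - 1 = (k - 1)^2 * n + (k - 2)" using assms(1) by simp
    then have "real n * real c = real (k - 1) * real (((k - 1)^2 * n + (k - 2)) choose (n - 1))" if "n \<ge> 1"
      using raney_closed_form[OF p that, of "k - 1"] cY by simp
    then show ?thesis using cY by (cases "n = 0") (simp_all add: field_simps)
  qed
  have "c = 0" if "\<nexists>n. n \<ge> 1 \<and> N = (k - 2) * k * n" "\<nexists>n. N = (k - 2) * (k * n + 1)"
  proof -
    have "\<nexists>n. N = K * n"
    proof
      assume "\<exists>n. N = K * n"
      then obtain n where "N = K * n" by blast
      moreover have "n \<ge> 1" using \<open>N = K * n\<close> False by (cases n) auto
      ultimately show False using that(1) unfolding K_def by blast
    qed
    then show ?thesis using c X0 Y0 that(2) by simp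
  qed
  then show ?thesis using False first second by blast
qed

end
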